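(* Let $R\subset\mathbb{R}^N$ be a (normalized) root system with reflection group $G$ and positive subsystem $R_+$, let $k\ge0$ be a non-negative multiplicity function on $R$, and let $E_k$ be the associated Dunkl kernel. There exists a constant non-zero vector $v=(v_g)_{g\in G}\in\mathbb{C}^{|G|}$ such that for all $y\in C$, $g\in G$ and each $\delta>0$, $$\lim_{|x|\to\infty,\ x\in C_\delta}\sqrt{w_k(x)w_k(y)}\;e^{-i\langle x,gy\rangle}E_k(ix,gy)=v_g.$$
   Context: A root system is a finite set $R\subset\mathbb{R}^N\setminus\{0\}$ with $R\cap\mathbb{R}\alpha=\{\pm\alpha\}$ and $\sigma_\alpha(R)=R$ for all $\alpha\in R$, where $\sigma_\alpha$ is the reflection in the hyperplane orthogonal to $\alpha$; it is normalized so that $\langle\alpha,\alpha\rangle=2$ for all $\alpha\in R$. $\langle\cdot,\cdot\rangle$ denotes the standard Euclidean scalar product and also its bilinear extension to $\mathbb{C}^N\times\mathbb{C}^N$. $G$ is the (finite) group generated by $\{\sigma_\alpha:\alpha\in R\}$, and $R_+$ is a fixed positive subsystem ($R=R_+\cup(-R_+)$ disjointly, the two parts separated by a hyperplane through the origin). A multiplicity function is a $G$-invariant function $k:R\to\mathbb{C}$; $k\ge 0$ means $k(\alpha)\ge0$ for all $\alpha$. For $\xi\in\mathbb{R}^N$ the Dunkl operator is $$T_\xi f(x)=\partial_\xi f(x)+\sum_{\alpha\in R_+}k(\alpha)\langle\alpha,\xi\rangle\frac{f(x)-f(\sigma_\alpha x)}{\langle\alpha,x\rangle}.$$ The Dunkl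 kernel $E_k$ ($k\geq 0$) is the holomorphic function on $\mathbb{C}^N\times\mathbb{C}^N$ such that for each $y\in\mathbb{C}^N$, $f=E_k(\cdot,y)$ is the unique real-analytic solution on $\mathbb{R}^N$ of $T_\xi f=\langle\xi,y\rangle f$ for all $\xi\in\mathbb{R}^N$, $f(0)=1$. $w_k(x)=\prod_{\alpha\in R_+}|\langle\alpha,x\rangle|^{2k(\alpha)}$. $C=\{x\in\mathbb{R}^N:\langle\alpha,x\rangle>0\ \text{for all }\alpha\in R_+\}$ is the Weyl chamber attached to $R_+$, and $C_\delta=\{x\in C:\langle\alpha,x\rangle>\delta|x|\ \text{for all }\alpha\in R_+\}$ for $\delta>0$. *)

theory Defs
  imports "HOL-Analysis.Analysis"
begin

subsection \<open>Root systems and reflection groups\<close>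

definition reflection :: "real ^ 'n \<Rightarrow> real ^ 'n \<Rightarrow> real ^ 'n" where
  "reflection \<alpha> x = x - (2 * (\<alpha> \<bullet> x) / (\<alpha> \<bullet> \<alpha>)) *\<^sub>R \<alpha>"

definition root_system :: "(real ^ 'n) set \<Rightarrow> bool" where
  "root_system R \<longleftrightarrow> finite R \<and> 0 \<notin> R \<and>
     (\<forall>\<alpha>\<in>R. R \<inter> span {\<alpha>} = {\<alpha>, - \<alpha>} \<and> reflection \<alpha> ` R = R)"

definition normalized_roots :: "(real ^ 'n) set \<Rightarrow> bool" where
  "normalized_roots R \<longleftrightarrow> (\<forall>\<alpha>\<in>R. \<alpha> \<bullet> \<alpha> = 2)"

text \<open>The separating hyperplane is the orthogonal complement of \<open>\<beta>\<close>; no root lies on it.\<close>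

definition positive_subsystem :: "(real ^ 'n) set \<Rightarrow> (real ^ 'n) set \<Rightarrow> bool" where
  "positive_subsystem R Rp \<longleftrightarrow>
     R = Rp \<union> uminus ` Rp \<and> Rp \<inter> uminus ` Rp = {} \<and> (\<exists>\<beta>. \<forall>\<alpha>\<in>Rp. \<beta> \<bullet> \<alpha> > 0)"

inductive_set reflection_group :: "(real ^ 'n) set \<Rightarrow> (real ^ 'n \<Rightarrow> real ^ 'n) set"
  for R :: "(real ^ 'n) set" where
  id: "id \<in> reflection_group R"
| reflection: "\<alpha> \<in> R \<Longrightarrow> reflection \<alpha> \<in> reflection_group R"
| comp: "g \<in> reflection_group R \<Longrightarrow> h \<in> reflection_group R \<Longrightarrow> g \<circ> h \<in> reflection_group R"
| inv: "g \<in> reflection_group R \<Longrightarrow> inv g \<in> reflection_group R"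

text \<open>Only non-negative multiplicity functions are needed, so they are real-valued. The values
  outside \<open>R\<close> are irrelevant.\<close>

definition nonneg_multiplicity :: "(real ^ 'n) set \<Rightarrow> (real ^ 'n \<Rightarrow> real) \<Rightarrow> bool" where
  "nonneg_multiplicity R k \<longleftrightarrow>
     (\<forall>g\<in>reflection_group R. \<forall>\<alpha>\<in>R. k (g \<alpha>) = k \<alpha>) \<and> (\<forall>\<alpha>\<in>R. 0 \<le> k \<alpha>)"

definition weyl_chamber :: "(real ^ 'n) set \<Rightarrow> (real ^ 'n) set" where
  "weyl_chamber Rp = {x. \<forall>\<alpha>\<in>Rp. \<alpha> \<bullet> x > 0}"

definition weyl_chamber_delta :: "(real ^ 'n) set \<Rightarrow> real \<Rightarrow> (real ^ 'n) set" where
  "weyl_chamber_delta Rp \<delta> = {x \<in> weyl_chamber Rp. \<forall>\<alpha>\<in>Rp. \<alpha> \<bullet> x > \<delta> * norm x}"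

text \<open>The case distinction is needed because \<^term>\<open>0 powr (0::real) = 0\<close>, whereas a root with
  \<open>k \<alpha> = 0\<close> contributes the factor \<open>1\<close> everywhere.\<close>

definition dunkl_weight :: "(real ^ 'n) set \<Rightarrow> (real ^ 'n \<Rightarrow> real) \<Rightarrow> real ^ 'n \<Rightarrow> real" where
  "dunkl_weight Rp k x = (\<Prod>\<alpha>\<in>Rp. if k \<alpha> = 0 then 1 else \<bar>\<alpha> \<bullet> x\<bar> powr (2 * k \<alpha>))"

subsection \<open>Dunkl operators\<close>

text \<open>On the hyperplane \<open>\<alpha> \<bullet> x = 0\<close> the difference quotient stands for its continuous extension.
  For a continuously differentiable \<open>f\<close> and a normalized root, \<open>\<alpha> \<bullet> \<alpha> = 2\<close>, the extension
  is the directional derivative of \<open>f\<close> along \<open>\<alpha>\<close>, because then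
  \<open>reflection \<alpha> x = x - (\<alpha> \<bullet> x) *\<^sub>R \<alpha>\<close>.\<close>

definition dunkl_quotient :: "real ^ 'n \<Rightarrow> (real ^ 'n \<Rightarrow> complex) \<Rightarrow> real ^ 'n \<Rightarrow> complex" where
  "dunkl_quotient \<alpha> f x =
     (if \<alpha> \<bullet> x = 0 then frechet_derivative f (at x) \<alpha>
      else (f x - f (reflection \<alpha> x)) / of_real (\<alpha> \<bullet> x))"

definition dunkl_operator ::
  "(real ^ 'n) set \<Rightarrow> (real ^ 'n \<Rightarrow> real) \<Rightarrow> real ^ 'n \<Rightarrow>
   (real ^ 'n \<Rightarrow> complex) \<Rightarrow> real ^ 'n \<Rightarrow> complex" where
  "dunkl_operator Rp k \<xi> f x =
     frechet_derivative f (at x) \<xi> +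
     (\<Sum>\<alpha>\<in>Rp. of_real (k \<alpha>) * of_real (\<alpha> \<bullet> \<xi>) * dunkl_quotient \<alpha> f x)"

subsection \<open>The Dunkl kernel\<close>

definition cvec :: "real ^ 'n \<Rightarrow> complex ^ 'n" where
  "cvec x = (\<chi> i. of_real (x $ i))"

text \<open>The bilinear (not sesquilinear) extension of the scalar product.\<close>

definition cbilinear :: "complex ^ 'n \<Rightarrow> complex ^ 'n \<Rightarrow> complex" where
  "cbilinear x y = (\<Sum>i\<in>UNIV. x $ i * y $ i)"

text \<open>Local expansion into power series; \<open>m\<close> ranges over all multi-indices.\<close>

definition real_analytic :: "(real ^ 'n \<Rightarrow> complex) \<Rightarrow> bool" where
  "real_analytic f \<longleftrightarrow>
     (\<forall>a. \<exists>r>0. \<exists>c :: ('n \<Rightarrow> nat) \<Rightarrow> complex. \<forall>x\<in>ball a r.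
        ((\<lambda>m. c m * (\<Prod>i\<in>UNIV. of_real ((x $ i - a $ i) ^ m i))) has_sum f x) UNIV)"

text \<open>Joint holomorphy: the real Frechet derivative exists everywhere and is complex-linear.\<close>

definition entire2 :: "(complex ^ 'n \<Rightarrow> complex ^ 'n \<Rightarrow> complex) \<Rightarrow> bool" where
  "entire2 E \<longleftrightarrow>
     (\<forall>p. \<exists>D. ((\<lambda>(x, y). E x y) has_derivative D) (at p) \<and>
        (\<forall>c u v. D (c *s u, c *s v) = c * D (u, v)))"

definition dunkl_eigenfunction ::
  "(real ^ 'n) set \<Rightarrow> (real ^ 'n \<Rightarrow> real) \<Rightarrow> complex ^ 'n \<Rightarrow> (real ^ 'n \<Rightarrow> complex) \<Rightarrow> bool" where
  "dunkl_eigenfunction Rp k y f \<longleftrightarrow>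
     real_analytic f \<and> f 0 = 1 \<and>
     (\<forall>\<xi> x. dunkl_operator Rp k \<xi> f x = cbilinear (cvec \<xi>) y * f x)"

text \<open>The equivalence says that the restriction of \<open>E _ y\<close> to real arguments is a normalized joint
  eigenfunction, and that it is the only one.\<close>

definition is_dunkl_kernel ::
  "(real ^ 'n) set \<Rightarrow> (real ^ 'n \<Rightarrow> real) \<Rightarrow>
   (complex ^ 'n \<Rightarrow> complex ^ 'n \<Rightarrow> complex) \<Rightarrow> bool" where
  "is_dunkl_kernel Rp k E \<longleftrightarrow>
     entire2 E \<and> (\<forall>y f. dunkl_eigenfunction Rp k y f \<longleftrightarrow> f = (\<lambda>x. E (cvec x) y))"

end

theory Submission
  imports Defs "HOL-Complex_Analysis.Complex_Analysis"
begin

text \<open>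
Fix a point \<open>y\<close> of the chamber. For \<open>g\<close> in the reflection group let \<open>F g x\<close> be the expression whose limit is
asked for. The Dunkl system for the kernel, together with the invariance of the kernel under the group,
becomes a closed linear system for the vector of all \<open>F g\<close>: the weight and the exponential factor are chosen
so that in the derivative of \<open>F g\<close> in direction \<open>\<xi>\<close> only the terms
\<open>k \<alpha> * (\<alpha> \<bullet> \<xi>) / (\<alpha> \<bullet> x) * cis (- (\<alpha> \<bullet> x) * (\<alpha> \<bullet> g y)) * F (reflection \<alpha> \<circ> g) x\<close>
remain (\<open>amplitude_line_derivative\<close>). The coefficients are of size \<open>1 / norm x\<close>, which is not integrable,
but they oscillate with nonzero frequencies. One integration by parts replaces them by coefficients of size
\<open>1 / (norm x)^2\<close>, at the expense of a correction of relative size \<open>1 / norm x\<close>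
(\<open>oscillatory_system_estimate\<close>). So the vector converges along every ray in the chamber. Inside
\<open>weyl_chamber_delta Rp \<delta>\<close> points at comparable distance are joined by segments along which the vector changes
by \<open>O(1 / norm x)\<close>. Therefore the limit does not depend on the direction and is attained in the sense of
the theorem. Since the relative change far out is small, the limit can vanish only if the vector vanishes
somewhere on a ray, and an energy estimate excludes that.

It remains to see that the limit does not depend on \<open>y\<close>. The kernel is symmetric and homogeneous, so
\<open>F g (t x)\<close> for the parameter \<open>y\<close> equals \<open>F (inv g) (t y)\<close> for the parameter \<open>x\<close>
(\<open>amplitude_swap\<close>). The limit of the latter does not depend on its direction \<open>y\<close>.

Symmetry, homogeneity and invariance of the kernel all come from one uniqueness result,
\<open>radial_equation_unique\<close>. It uses the eigenvalue equation at \<open>x\<close> in the direction of \<open>x\<close> only; for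
\<open>k \<ge> 0\<close> the reflection terms are dissipative, and a Gronwall argument for the sum of the squared absolute
values over an orbit gives uniqueness among functions that are continuous on rays and have a prescribed value at the origin.
\<close>

section \<open>Reflection groups\<close>

lemma linear_reflection: "linear (reflection \<alpha>)"
  by (rule linearI) (simp_all add: reflection_def inner_add_right algebra_simps add_divide_distrib)

locale root_datum =
  fixes R Rp :: "(real ^ 'n) set" and k :: "real ^ 'n \<Rightarrow> real"
  assumes root: "root_system R" and normalized: "normalized_roots R"
    and positive: "positive_subsystem R Rp" and multiplicity: "nonneg_multiplicity R k"
begin

abbreviation G where "G \<equiv> reflection_group R"

lemma finite_R: "finite R" using root by (simp add: root_system_def)

lemma Rp_subset: "Rp \<subseteq> R" using positive by (auto simp: positive_subsystem_def)

lemma finite_Rp: "finite Rp" using finite_R Rp_subset finite_subset by blast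

lemma root_square: "\<alpha> \<in> R \<Longrightarrow> \<alpha> \<bullet> \<alpha> = 2"
  using normalized by (simp add: normalized_roots_def)

lemma reflection_root: "\<alpha> \<in> R \<Longrightarrow> reflection \<alpha> x = x - (\<alpha> \<bullet> x) *\<^sub>R \<alpha>"
  by (simp add: reflection_def root_square)

lemma reflection_reflection: "\<alpha> \<in> R \<Longrightarrow> reflection \<alpha> (reflection \<alpha> x) = x"
  by (simp add: reflection_root root_square inner_diff_right algebra_simps)

lemma reflection_inner: "\<alpha> \<in> R \<Longrightarrow> reflection \<alpha> x \<bullet> reflection \<alpha> y = x \<bullet> y"
  by (simp add: reflection_root root_square inner_diff_right inner_diff_left inner_commute algebra_simps)

text \<open>The last clause, that every group element fixes the orthogonal complement of the roots, is what
makes an element determined by its action on \<open>R\<close>; the roots need not span the space.\<close>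

lemma group_structure:
  assumes "g \<in> G"
  shows "linear g \<and> bij g \<and> (\<forall>x y. g x \<bullet> g y = x \<bullet> y) \<and> g ` R = R \<and>
    (\<forall>x. (\<forall>\<alpha>\<in>R. \<alpha> \<bullet> x = 0) \<longrightarrow> g x = x)"
  using assms
proof induction
  case id
  show ?case by (simp add: linear_id del: id_apply) simp
next
  case (reflection \<alpha>)
  have "bij (reflection \<alpha>)"
    by (rule o_bij[of "reflection \<alpha>"]) (auto simp: fun_eq_iff reflection_reflection reflection)
  moreover have "reflection \<alpha> ` R = R" using root reflection by (auto simp: root_system_def)
  ultimately show ?case using reflection
    by (intro conjI linear_reflection) (simp_all add: reflection_inner, simp add: reflection_root)
next
  case (comp g h)
  then have "linear (g \<circ> h)" "bij (g \<circ> h)" "(g \<circ> h) ` R = R"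
    by (simp_all only: linear_compose bij_comp image_comp[symmetric])
  moreover have "\<forall>x y. (g \<circ> h) x \<bullet> (g \<circ> h) y = x \<bullet> y"
    "\<forall>x. (\<forall>\<alpha>\<in>R. \<alpha> \<bullet> x = 0) \<longrightarrow> (g \<circ> h) x = x"
    using comp.IH by (simp, metis o_apply)
  ultimately show ?case by metis
next
  case (inv g)
  then have g: "linear g" "bij g" "\<And>x y. g x \<bullet> g y = x \<bullet> y" "g ` R = R"
    "\<And>x. (\<forall>\<alpha>\<in>R. \<alpha> \<bullet> x = 0) \<Longrightarrow> g x = x" by auto
  have gi: "g (inv g x) = x" "inv g (g x) = x" for x
    using g(2) by (simp_all add: bij_is_surj surj_f_inv_f bij_is_inj)
  have "inv g (x + y) = inv g x + inv g y" for x y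
    using gi(2)[of "inv g x + inv g y"] by (simp add: linear_add[OF g(1)] gi(1))
  moreover have "inv g (c *\<^sub>R x) = c *\<^sub>R inv g x" for c x
    using gi(2)[of "c *\<^sub>R inv g x"] by (simp add: linear_scale[OF g(1)] gi(1))
  ultimately have "linear (inv g)" by (intro linearI)
  moreover have "inv g x \<bullet> inv g y = x \<bullet> y" for x y using g(3)[of "inv g x" "inv g y"] gi by simp
  moreover have "inv g ` R = R" using image_inv_f_f[OF bij_is_inj[OF g(2)], of R] by (simp add: g(4))
  moreover have "inv g x = x" if "\<forall>\<alpha>\<in>R. \<alpha> \<bullet> x = 0" for x
    using g(5)[OF that] gi(2)[of x] by simp
  ultimately show ?case using bij_imp_bij_inv[OF g(2)] by (intro conjI) auto
qed

lemma group_linear: "g \<in> G \<Longrightarrow> linear g"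
  and group_bij: "g \<in> G \<Longrightarrow> bij g"
  and group_inner: "g \<in> G \<Longrightarrow> g x \<bullet> g y = x \<bullet> y"
  and group_roots: "g \<in> G \<Longrightarrow> g ` R = R"
  and group_fixes: "g \<in> G \<Longrightarrow> (\<And>\<alpha>. \<alpha> \<in> R \<Longrightarrow> \<alpha> \<bullet> x = 0) \<Longrightarrow> g x = x"
  using group_structure by blast+

lemma group_inverse: "g \<in> G \<Longrightarrow> g (inv g x) = x" "g \<in> G \<Longrightarrow> inv g (g x) = x"
  using group_bij by (simp_all add: bij_is_surj surj_f_inv_f bij_is_inj)

lemma group_inner_adjoint: "g \<in> G \<Longrightarrow> x \<bullet> g y = inv g x \<bullet> y"
  using group_inner[of g "inv g x" y] by (simp add: group_inverse)

lemma group_scale: "g \<in> G \<Longrightarrow> g (t *\<^sub>R x) = t *\<^sub>R g x"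
  using group_linear linear_scale by blast

lemma multiplicity_nonneg: "\<alpha> \<in> R \<Longrightarrow> 0 \<le> k \<alpha>"
  using multiplicity by (auto simp: nonneg_multiplicity_def)

lemma multiplicity_invariant: "g \<in> G \<Longrightarrow> \<alpha> \<in> R \<Longrightarrow> k (g \<alpha>) = k \<alpha>"
  using multiplicity by (auto simp: nonneg_multiplicity_def)

lemma reflection_self: "\<alpha> \<in> R \<Longrightarrow> reflection \<alpha> \<alpha> = - \<alpha>"
  by (simp add: reflection_root root_square algebra_simps scaleR_2)

lemma multiplicity_uminus: "\<alpha> \<in> R \<Longrightarrow> k (- \<alpha>) = k \<alpha>"
  using multiplicity_invariant[OF reflection_group.reflection] reflection_self by metis

text \<open>An element of the group is determined by the permutation of the finite set \<open>R\<close> that it induces: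
that permutation fixes it on the span of \<open>R\<close>, and on the orthogonal complement it is the identity.\<close>

lemma finite_group: "finite G"
proof (rule inj_on_finite)
  show "inj_on (\<lambda>g. restrict g R) G"
  proof (rule inj_onI)
    fix g h assume g: "g \<in> G" and h: "h \<in> G" and eq: "restrict g R = restrict h R"
    show "g = h"
    proof
      fix x
      obtain u v where u: "u \<in> span R" and v: "\<And>w. w \<in> span R \<Longrightarrow> orthogonal v w" and x: "x = u + v"
        using orthogonal_subspace_decomp_exists by blast
      have "g v = v" "h v = v" using v
        by (auto intro!: group_fixes g h simp: orthogonal_def inner_commute span_base)
      moreover have "g u = h u"
        by (rule linear_eq_on_span[OF group_linear group_linear, OF g h _ u])
          (metis eq restrict_apply')
      ultimately show "g x = h x" by (simp add: x linear_add group_linear g h)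
    qed
  qed
  show "(\<lambda>g. restrict g R) ` G \<subseteq> R \<rightarrow>\<^sub>E R"
    using group_roots by (fastforce simp: PiE_iff)
  show "finite (R \<rightarrow>\<^sub>E R)" by (simp add: finite_PiE finite_R)
qed

lemma reflection_comp: "\<alpha> \<in> R \<Longrightarrow> g \<in> G \<Longrightarrow> reflection \<alpha> \<circ> g \<in> G"
  by (simp add: reflection_group.intros)

lemma group_conjugates_reflection:
  assumes "g \<in> G" "\<alpha> \<in> R"
  shows "g (reflection \<alpha> x) = reflection (g \<alpha>) (g x)"
proof -
  have "g \<alpha> \<in> R" using assms group_roots by blast
  then show ?thesis using assms
    by (simp add: reflection_root linear_diff group_linear group_scale group_inner)
qed

lemma sum_roots_even:
  fixes \<Phi> :: "real ^ 'n \<Rightarrow> 'b::real_vector"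
  assumes "\<And>\<alpha>. \<alpha> \<in> R \<Longrightarrow> \<Phi> (- \<alpha>) = \<Phi> \<alpha>"
  shows "sum \<Phi> R = 2 *\<^sub>R sum \<Phi> Rp"
proof -
  have "R = Rp \<union> uminus ` Rp" "Rp \<inter> uminus ` Rp = {}"
    using positive by (auto simp: positive_subsystem_def)
  then have "sum \<Phi> R = sum \<Phi> Rp + sum \<Phi> (uminus ` Rp)"
    by (metis finite_Rp finite_imageI sum.union_disjoint)
  also have "sum \<Phi> (uminus ` Rp) = sum (\<lambda>\<alpha>. \<Phi> (- \<alpha>)) Rp"
    by (subst sum.reindex) (auto simp: inj_on_def)
  also have "\<dots> = sum \<Phi> Rp" using assms Rp_subset by (intro sum.cong) auto
  finally show ?thesis by (simp add: scaleR_2)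
qed

text \<open>A group element does not preserve \<open>Rp\<close>, but it permutes \<open>R\<close>, and for a function that is even on
\<open>R\<close> a sum over \<open>Rp\<close> is half of the sum over \<open>R\<close>.\<close>

lemma sum_positive_roots_invariant:
  fixes \<Phi> :: "real ^ 'n \<Rightarrow> 'b::real_vector"
  assumes g: "g \<in> G" and even: "\<And>\<alpha>. \<alpha> \<in> R \<Longrightarrow> \<Phi> (- \<alpha>) = \<Phi> \<alpha>"
  shows "(\<Sum>\<alpha>\<in>Rp. \<Phi> (g \<alpha>)) = sum \<Phi> Rp"
proof -
  have "2 *\<^sub>R (\<Sum>\<alpha>\<in>Rp. \<Phi> (g \<alpha>)) = (\<Sum>\<alpha>\<in>R. \<Phi> (g \<alpha>))"
    using even group_roots[OF g]
    by (intro sum_roots_even[symmetric]) (metis g group_linear linear_neg imageI)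
  also have "\<dots> = sum \<Phi> (g ` R)"
    using group_bij[OF g] by (subst sum.reindex) (auto simp: bij_def inj_on_def)
  also have "\<dots> = 2 *\<^sub>R sum \<Phi> Rp" using even by (simp add: group_roots g sum_roots_even)
  finally show ?thesis by simp
qed

end

section \<open>The radial part of the Dunkl system\<close>

lemma complex_energy_lower: "(norm a)\<^sup>2 - (norm b)\<^sup>2 \<le> 2 * Re (cnj a * (a - b))"
  and complex_energy_upper: "2 * Re (cnj a * (a - b)) \<le> 3 * (norm a)\<^sup>2 + (norm b)\<^sup>2"
proof -
  obtain p q r s where [simp]: "a = Complex p q" "b = Complex r s" by (metis complex_surj)
  have *: "0 \<le> (p - r)\<^sup>2 + (q - s)\<^sup>2" "0 \<le> (p + r)\<^sup>2 + (q + s)\<^sup>2" by simp_all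
  show "(norm a)\<^sup>2 - (norm b)\<^sup>2 \<le> 2 * Re (cnj a * (a - b))"
    "2 * Re (cnj a * (a - b)) \<le> 3 * (norm a)\<^sup>2 + (norm b)\<^sup>2"
    using * by (simp_all add: cmod_power2 power2_diff power2_sum)
      (simp_all add: power2_eq_square algebra_simps)
qed

lemma has_real_derivative_norm_square:
  fixes u :: "real \<Rightarrow> complex"
  assumes "(u has_vector_derivative u') (at t)"
  shows "((\<lambda>t. (norm (u t))\<^sup>2) has_real_derivative 2 * Re (cnj (u t) * u')) (at t)"
proof -
  note d = has_field_derivative_Re[OF assms] has_field_derivative_Im[OF assms]
  show ?thesis unfolding cmod_power2
    by (rule DERIV_cong[OF DERIV_add[OF DERIV_power[OF d(1)] DERIV_power[OF d(2)]]]) simp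
qed

context root_datum
begin

abbreviation \<kappa> :: real where "\<kappa> \<equiv> sum k Rp"

lemma \<kappa>_nonneg: "0 \<le> \<kappa>"
  using Rp_subset multiplicity_nonneg by (auto intro!: sum_nonneg)

lemma sum_reflection_comp:
  fixes N :: "(real ^ 'n \<Rightarrow> real ^ 'n) \<Rightarrow> 'b::comm_monoid_add"
  assumes "\<alpha> \<in> R"
  shows "(\<Sum>g\<in>G. N (reflection \<alpha> \<circ> g)) = sum N G"
  by (rule sum.reindex_bij_witness[where i = "\<lambda>g. reflection \<alpha> \<circ> g" and j = "\<lambda>g. reflection \<alpha> \<circ> g"])
    (auto simp: fun_eq_iff reflection_reflection assms reflection_comp)

text \<open>The operator \<open>u \<mapsto> u - u \<circ> (reflection \<alpha> \<circ> _)\<close> on functions on the group is symmetric with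
spectrum in \<open>{0, 2}\<close>, because composition with a reflection is an involution that permutes the group.
The lower bound makes the reflection terms dissipative for \<open>k \<ge> 0\<close>.\<close>

lemma reflection_energy:
  fixes u :: "(real ^ 'n \<Rightarrow> real ^ 'n) \<Rightarrow> complex"
  assumes "\<alpha> \<in> R"
  defines "Q \<equiv> (\<Sum>g\<in>G. 2 * Re (cnj (u g) * (u g - u (reflection \<alpha> \<circ> g))))"
  shows "0 \<le> Q" "Q \<le> 4 * (\<Sum>g\<in>G. (norm (u g))\<^sup>2)"
proof -
  have "(\<Sum>g\<in>G. (norm (u g))\<^sup>2 - (norm (u (reflection \<alpha> \<circ> g)))\<^sup>2) \<le> Q"
    unfolding Q_def by (intro sum_mono complex_energy_lower)
  then show "0 \<le> Q"
    by (simp add: sum_subtractf sum_reflection_comp[OF assms(1), of "\<lambda>g. (norm (u g))\<^sup>2"])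
  have "Q \<le> (\<Sum>g\<in>G. 3 * (norm (u g))\<^sup>2 + (norm (u (reflection \<alpha> \<circ> g)))\<^sup>2)"
    unfolding Q_def by (intro sum_mono complex_energy_upper)
  then show "Q \<le> 4 * (\<Sum>g\<in>G. (norm (u g))\<^sup>2)"
    by (simp add: sum.distrib sum_reflection_comp[OF assms(1), of "\<lambda>g. (norm (u g))\<^sup>2"]
        flip: sum_distrib_left)
qed

text \<open>This is the Dunkl eigenvalue equation \<open>T_\<xi> f = c \<langle>\<xi>, y\<rangle> f\<close> at the point \<open>x\<close> in the single
direction \<open>\<xi> = x\<close>. There the difference quotients lose their denominators, and only the values of \<open>f\<close> on
rays through the origin enter, so the equation survives substitutions that would be awkward for the
full system.\<close>

definition radial_equation :: "complex \<Rightarrow> real ^ 'n \<Rightarrow> (real ^ 'n \<Rightarrow> complex) \<Rightarrow> bool" where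
  "radial_equation c y f \<longleftrightarrow>
     (\<forall>x. ((\<lambda>t. f (t *\<^sub>R x)) has_vector_derivative
        c * of_real (x \<bullet> y) * f x - (\<Sum>\<alpha>\<in>Rp. of_real (k \<alpha>) * (f x - f (reflection \<alpha> x)))) (at 1))"

lemma radial_equation_on_ray:
  assumes "radial_equation c y f" "t > 0"
  shows "((\<lambda>t. f (t *\<^sub>R x)) has_vector_derivative
    c * of_real (x \<bullet> y) * f (t *\<^sub>R x)
    - of_real (1 / t) * (\<Sum>\<alpha>\<in>Rp. of_real (k \<alpha>) * (f (t *\<^sub>R x) - f (t *\<^sub>R reflection \<alpha> x)))) (at t)"
proof -
  define r where "r = c * of_real (t *\<^sub>R x \<bullet> y) * f (t *\<^sub>R x)
    - (\<Sum>\<alpha>\<in>Rp. of_real (k \<alpha>) * (f (t *\<^sub>R x) - f (reflection \<alpha> (t *\<^sub>R x))))"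
  have s: "((\<lambda>s. s / t) has_vector_derivative 1 / t) (at t)"
    by (auto intro!: derivative_eq_intros)
  have "t / t = 1" using assms(2) by simp
  then have "((\<lambda>s. f (s *\<^sub>R (t *\<^sub>R x))) has_vector_derivative r) (at (t / t))"
    using assms(1) unfolding radial_equation_def r_def by (simp only:)
  from vector_diff_chain_at[OF s this]
  have "((\<lambda>s. f (s *\<^sub>R x)) has_vector_derivative (1 / t) *\<^sub>R r) (at t)"
    using assms(2) by (simp add: o_def)
  also have "(1 / t) *\<^sub>R r = c * of_real (x \<bullet> y) * f (t *\<^sub>R x)
    - of_real (1 / t) * (\<Sum>\<alpha>\<in>Rp. of_real (k \<alpha>) * (f (t *\<^sub>R x) - f (t *\<^sub>R reflection \<alpha> x)))"
    using assms(2) by (simp add: r_def scaleR_conv_of_real[where 'a = complex]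
        linear_scale[OF linear_reflection] right_diff_distrib)
  finally show ?thesis .
qed

text \<open>The values of \<open>f\<close> on the rays through the orbit of \<open>x\<close> satisfy a closed linear system of ordinary
differential equations with a regular singularity at \<open>t = 0\<close>. Its singular part is dissipative by
\<open>reflection_energy\<close>, so the growth of the squared norm is controlled without a \<open>1 / t\<close> term from above,
and with one only from below.\<close>

lemma radial_energy:
  fixes f :: "real ^ 'n \<Rightarrow> complex" and x y :: "real ^ 'n" and c :: complex
  assumes eq: "radial_equation c y f" and t: "t > 0"
  defines "e \<equiv> \<lambda>t. \<Sum>g\<in>G. (norm (f (t *\<^sub>R g x)))\<^sup>2"
    and "M \<equiv> \<Sum>g\<in>G. norm c * \<bar>g x \<bullet> y\<bar>"
  obtains e' where "(e has_real_derivative e') (at t)"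
    and "e' \<le> 2 * M * e t" and "- (4 * \<kappa> / t + 2 * M) * e t \<le> e'"
proof -
  define u where "u = (\<lambda>g. f (t *\<^sub>R g x))"
  define b where "b = (\<lambda>g. c * of_real (g x \<bullet> y))"
  define u' where "u' = (\<lambda>g. b g * u g
    - of_real (1 / t) * (\<Sum>\<alpha>\<in>Rp. of_real (k \<alpha>) * (u g - u (reflection \<alpha> \<circ> g))))"
  define B where "B = (\<Sum>g\<in>G. 2 * Re (b g) * (norm (u g))\<^sup>2)"
  define Q where "Q = (\<Sum>\<alpha>\<in>Rp. k \<alpha> * (\<Sum>g\<in>G. 2 * Re (cnj (u g) * (u g - u (reflection \<alpha> \<circ> g)))))"
  have et: "e t = (\<Sum>g\<in>G. (norm (u g))\<^sup>2)" by (simp add: e_def u_def)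
  have "((\<lambda>t. f (t *\<^sub>R g x)) has_vector_derivative u' g) (at t)" for g
    using radial_equation_on_ray[OF eq t, of "g x"] by (simp add: u'_def u_def b_def)
  then have deriv: "(e has_real_derivative (\<Sum>g\<in>G. 2 * Re (cnj (u g) * u' g))) (at t)"
    unfolding e_def u_def by (intro DERIV_sum has_real_derivative_norm_square)
  have "(\<Sum>g\<in>G. 2 * Re (cnj (u g) * u' g)) = (\<Sum>g\<in>G. 2 * Re (b g) * (norm (u g))\<^sup>2
     - (1 / t) * (\<Sum>\<alpha>\<in>Rp. k \<alpha> * (2 * Re (cnj (u g) * (u g - u (reflection \<alpha> \<circ> g))))))"
  proof (rule sum.cong)
    fix g
    have 1: "cnj (u g) * (b g * u g) = b g * of_real ((norm (u g))\<^sup>2)"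
      by (metis complex_norm_square mult.commute mult.left_commute)
    have "cnj (u g) * u' g = b g * of_real ((norm (u g))\<^sup>2)
       - of_real (1 / t) * (\<Sum>\<alpha>\<in>Rp. of_real (k \<alpha>) * (cnj (u g) * (u g - u (reflection \<alpha> \<circ> g))))"
      unfolding u'_def right_diff_distrib 1 by (simp add: sum_distrib_left algebra_simps)
    moreover have re: "Re (of_real r * z) = r * Re z" "Re (z * of_real r) = r * Re z" for r z by simp_all
    ultimately show "2 * Re (cnj (u g) * u' g) = 2 * Re (b g) * (norm (u g))\<^sup>2
     - (1 / t) * (\<Sum>\<alpha>\<in>Rp. k \<alpha> * (2 * Re (cnj (u g) * (u g - u (reflection \<alpha> \<circ> g)))))"
      by (simp only: minus_complex.sel Re_sum re)
        (simp add: sum_distrib_left right_diff_distrib mult_ac)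
  qed simp
  also have "\<dots> = B - (1 / t) * Q"
    unfolding B_def Q_def sum_subtractf by (simp add: sum_distrib_left sum.swap[of _ Rp G])
  finally have e': "(\<Sum>g\<in>G. 2 * Re (cnj (u g) * u' g)) = B - (1 / t) * Q" .
  have kR: "\<alpha> \<in> Rp \<Longrightarrow> \<alpha> \<in> R \<and> 0 \<le> k \<alpha>" for \<alpha> using Rp_subset multiplicity_nonneg by auto
  have Q0: "0 \<le> Q" unfolding Q_def
    using kR by (intro sum_nonneg mult_nonneg_nonneg reflection_energy(1)) auto
  have "Q \<le> (\<Sum>\<alpha>\<in>Rp. k \<alpha> * (4 * e t))" unfolding Q_def et
    using kR by (intro sum_mono mult_left_mono reflection_energy(2)) auto
  then have Q1: "Q \<le> 4 * \<kappa> * e t" by (simp only: sum_distrib_right[symmetric])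
  have bM: "\<bar>Re (b g)\<bar> \<le> M" if "g \<in> G" for g
  proof -
    have "\<bar>Re (b g)\<bar> \<le> norm (b g)" by (rule abs_Re_le_cmod)
    also have "\<dots> \<le> M" unfolding M_def using that
      by (intro order.trans[OF _ member_le_sum]) (auto simp: b_def norm_mult finite_group)
    finally show ?thesis .
  qed
  have "\<bar>B\<bar> \<le> (\<Sum>g\<in>G. \<bar>2 * Re (b g) * (norm (u g))\<^sup>2\<bar>)" unfolding B_def by (rule sum_abs)
  also have "\<dots> \<le> (\<Sum>g\<in>G. 2 * M * (norm (u g))\<^sup>2)"
    using bM by (intro sum_mono) (auto simp: abs_mult mult_right_mono)
  also have "\<dots> = 2 * M * e t" unfolding et by (simp add: sum_distrib_left)
  finally have B: "\<bar>B\<bar> \<le> 2 * M * e t" .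
  show ?thesis
  proof (rule that[OF deriv])
    have "(1 / t) * Q \<ge> 0" using t Q0 by simp
    then show "(\<Sum>g\<in>G. 2 * Re (cnj (u g) * u' g)) \<le> 2 * M * e t"
      using B unfolding e' by linarith
    have "(1 / t) * Q \<le> (1 / t) * (4 * \<kappa> * e t)" using t Q1 by (intro mult_left_mono) auto
    then show "- (4 * \<kappa> / t + 2 * M) * e t \<le> (\<Sum>g\<in>G. 2 * Re (cnj (u g) * u' g))"
      using B unfolding e' by (simp add: algebra_simps)
  qed
qed

lemma radial_equation_diff:
  assumes "radial_equation c y f" "radial_equation c y h"
  shows "radial_equation c y (\<lambda>x. f x - h x)"
  unfolding radial_equation_def
proof
  fix x
  note d = has_vector_derivative_diff[OF assms(1)[unfolded radial_equation_def, rule_format, of x]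
      assms(2)[unfolded radial_equation_def, rule_format, of x]]
  show "((\<lambda>t. f (t *\<^sub>R x) - h (t *\<^sub>R x)) has_vector_derivative
     c * of_real (x \<bullet> y) * (f x - h x)
      - (\<Sum>\<alpha>\<in>Rp. of_real (k \<alpha>) * (f x - h x - (f (reflection \<alpha> x) - h (reflection \<alpha> x))))) (at 1)"
    by (rule back_subst[of "\<lambda>d. (_ has_vector_derivative d) _", OF d])
      (simp add: right_diff_distrib sum_subtractf)
qed

lemma id_in_group: "(\<lambda>x. x) \<in> G"
  using reflection_group.id[of R] by (simp add: id_def)

text \<open>By Gronwall, the energy of the difference of two solutions cannot leave its initial value \<open>0\<close>; the
upper bound on its growth is regular at \<open>t = 0\<close>.\<close>

lemma radial_equation_unique:
  assumes f: "radial_equation c y f" and h: "radial_equation c y h" and 0: "f 0 = h 0"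
    and cont: "\<And>x. continuous_on {0..} (\<lambda>t. f (t *\<^sub>R x))" "\<And>x. continuous_on {0..} (\<lambda>t. h (t *\<^sub>R x))"
  shows "f = h"
proof
  fix x
  define M where "M = (\<Sum>g\<in>G. norm c * \<bar>g x \<bullet> y\<bar>)"
  define e where "e = (\<lambda>t. \<Sum>g\<in>G. (norm (f (t *\<^sub>R g x) - h (t *\<^sub>R g x)))\<^sup>2)"
  have "e 1 * exp (- 2 * M * 1) \<le> e 0 * exp (- 2 * M * 0)"
  proof (rule DERIV_nonpos_imp_decreasing_open[where f = "\<lambda>t. e t * exp (- 2 * M * t)"])
    fix t :: real assume "0 < t" "t < 1"
    then obtain e' where e': "(e has_real_derivative e') (at t)" "e' \<le> 2 * M * e t"
      using radial_energy[OF radial_equation_diff[OF f h], of t x] unfolding e_def M_def by blast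
    have "((\<lambda>t. e t * exp (- 2 * M * t)) has_real_derivative (e' - 2 * M * e t) * exp (- 2 * M * t)) (at t)"
      by (auto intro!: derivative_eq_intros e'(1) simp: algebra_simps)
    then show "\<exists>d. ((\<lambda>t. e t * exp (- 2 * M * t)) has_real_derivative d) (at t) \<and> d \<le> 0"
      using e'(2) by (intro exI conjI) (auto simp: mult_nonpos_nonneg)
  next
    show "continuous_on {0..1} (\<lambda>t. e t * exp (- 2 * M * t))"
      unfolding e_def
      by (intro continuous_intros continuous_on_subset[OF cont(1)] continuous_on_subset[OF cont(2)]) auto
  qed simp
  moreover have "e 0 = 0" by (simp add: e_def 0)
  ultimately have "e 1 \<le> 0" using exp_gt_zero[of "- 2 * M * 1"] by (metis mult_zero_left mult_le_0_iff not_le)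
  moreover have "(norm (f x - h x))\<^sup>2 \<le> e 1" unfolding e_def
    using member_le_sum[OF id_in_group, of "\<lambda>g. (norm (f (1 *\<^sub>R g x) - h (1 *\<^sub>R g x)))\<^sup>2"]
    by (simp add: finite_group)
  ultimately have "(norm (f x - h x))\<^sup>2 \<le> 0" by linarith
  then show "f x = h x" by simp
qed

text \<open>The lower bound on the growth of the energy says that the energy times \<open>t powr (4 * \<kappa>) * exp (2 * M * t)\<close>
is nondecreasing. If the energy vanished at some \<open>t > 0\<close>, it would vanish on the whole interval down to \<open>0\<close>,
where it is the order of the group times the square of \<open>norm (f 0)\<close>.\<close>

lemma radial_solution_nonzero:
  assumes f: "radial_equation c y f" and f0: "f 0 \<noteq> 0" and t: "0 < t"
    and cont: "\<And>x. continuous_on {0..} (\<lambda>t. f (t *\<^sub>R x))"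
  shows "\<exists>g\<in>G. f (t *\<^sub>R g x) \<noteq> 0"
proof (rule ccontr)
  assume not: "\<not> ?thesis"
  define M where "M = (\<Sum>g\<in>G. norm c * \<bar>g x \<bullet> y\<bar>)"
  define e where "e = (\<lambda>t. \<Sum>g\<in>G. (norm (f (t *\<^sub>R g x)))\<^sup>2)"
  define w where "w = (\<lambda>s::real. s powr (4 * \<kappa>) * exp (2 * M * s))"
  have e_nonneg: "0 \<le> e s" for s by (simp add: e_def sum_nonneg)
  have e_zero: "e s = 0" if s: "0 < s" "s < t" for s
  proof -
    have "e s * w s \<le> e t * w t"
    proof (rule DERIV_nonneg_imp_nondecreasing[where f = "\<lambda>s. e s * w s"])
      fix \<tau> assume "s \<le> \<tau>" "\<tau> \<le> t"
      then have \<tau>: "0 < \<tau>" using s by simp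
      then obtain e' where e': "(e has_real_derivative e') (at \<tau>)" "- (4 * \<kappa> / \<tau> + 2 * M) * e \<tau> \<le> e'"
        using radial_energy[OF f, of \<tau> x] unfolding e_def M_def by blast
      have "((\<lambda>s. e s * w s) has_real_derivative (e' + (4 * \<kappa> / \<tau> + 2 * M) * e \<tau>) * w \<tau>) (at \<tau>)"
        unfolding w_def using \<tau>
        by (auto intro!: derivative_eq_intros e'(1) simp: algebra_simps powr_diff)
      moreover have "0 \<le> (e' + (4 * \<kappa> / \<tau> + 2 * M) * e \<tau>) * w \<tau>"
        using e'(2) by (intro mult_nonneg_nonneg) (auto simp: w_def algebra_simps)
      ultimately show "\<exists>d. ((\<lambda>s. e s * w s) has_real_derivative d) (at \<tau>) \<and> 0 \<le> d" by blast
    qed (use s in simp)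
    moreover have "e t = 0" using not by (simp add: e_def)
    moreover have "w s > 0" using s by (simp add: w_def)
    ultimately show ?thesis using e_nonneg[of s]
      by (metis mult_zero_left mult_le_0_iff not_le order_antisym)
  qed
  have "continuous_on {0..} e" unfolding e_def by (intro continuous_intros cont)
  then have "(e \<longlongrightarrow> e 0) (at 0 within {0..})" by (simp add: continuous_on_def)
  then have "(e \<longlongrightarrow> e 0) (at_right 0)" by (rule tendsto_within_subset) auto
  moreover have "(e \<longlongrightarrow> 0) (at_right 0)"
    by (rule tendsto_eventually) (use e_zero t in \<open>auto simp: eventually_at_right_field\<close>)
  ultimately have "e 0 = 0" using tendsto_unique trivial_limit_at_right_real by blast
  moreover have "e 0 = card G * (norm (f 0))\<^sup>2"
    by (simp add: e_def linear_0[OF group_linear])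
  ultimately show False using f0 id_in_group finite_group by auto
qed

end

section \<open>Symmetries of the Dunkl kernel\<close>

lemma linear_cvec: "linear cvec"
  by (rule linearI) (simp_all add: cvec_def vec_eq_iff scaleR_conv_of_real[where 'a = complex])

lemma cvec_scale: "cvec (t *\<^sub>R x) = of_real t *s cvec x"
  by (simp add: cvec_def vec_eq_iff)

lemma cbilinear_cvec: "cbilinear (cvec x) (c *s cvec y) = c * of_real (x \<bullet> y)"
  by (simp add: cbilinear_def cvec_def inner_vec_def sum_distrib_left mult_ac)

lemma has_derivative_cvec: "(cvec has_derivative cvec) F"
  by (intro bounded_linear_imp_has_derivative linear_conv_bounded_linear[THEN iffD1] linear_cvec)

lemma entire2_holomorphic_in_scalar:
  fixes E :: "complex ^ 'n \<Rightarrow> complex ^ 'n \<Rightarrow> complex"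
  assumes "entire2 E"
  shows "(\<lambda>z. E (z *s a) b) holomorphic_on S" "(\<lambda>z. E a (z *s b)) holomorphic_on S"
proof -
  have lin: "linear (\<lambda>z. z *s v)" for v :: "complex ^ 'n"
    by (rule linearI) (simp_all add: vec_eq_iff distrib_right scaleR_conv_of_real[where 'a = complex])
  have scale: "((\<lambda>z. z *s v) has_derivative (\<lambda>h. h *s v)) F" for v :: "complex ^ 'n" and F
    by (intro bounded_linear_imp_has_derivative linear_conv_bounded_linear[THEN iffD1] lin)
  have "((\<lambda>z. E (z *s a) b) has_derivative (*) (D (a, 0))) (at z)"
    if D: "((\<lambda>(x, y). E x y) has_derivative D) (at (z *s a, b))"
      and c: "\<And>c u v. D (c *s u, c *s v) = c * D (u, v)" for z D
  proof -
    have "((\<lambda>z. (z *s a, b)) has_derivative (\<lambda>h. (h *s a, 0))) (at z)"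
      by (intro has_derivative_Pair scale has_derivative_const)
    from has_derivative_compose[OF this D]
    have "((\<lambda>z. E (z *s a) b) has_derivative (\<lambda>h. D (h *s a, 0))) (at z)" by simp
    also have "(\<lambda>h. D (h *s a, 0)) = (*) (D (a, 0))"
      using c[of _ a 0] by (simp add: fun_eq_iff mult.commute)
    finally show ?thesis .
  qed
  then show "(\<lambda>z. E (z *s a) b) holomorphic_on S"
    using assms unfolding entire2_def holomorphic_on_def field_differentiable_def has_field_derivative_def
    by (meson has_derivative_at_withinI)
  have "((\<lambda>z. E a (z *s b)) has_derivative (*) (D (0, b))) (at z)"
    if D: "((\<lambda>(x, y). E x y) has_derivative D) (at (a, z *s b))"
      and c: "\<And>c u v. D (c *s u, c *s v) = c * D (u, v)" for z D
  proof -
    have "((\<lambda>z. (a, z *s b)) has_derivative (\<lambda>h. (0, h *s b))) (at z)"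
      by (intro has_derivative_Pair scale has_derivative_const)
    from has_derivative_compose[OF this D]
    have "((\<lambda>z. E a (z *s b)) has_derivative (\<lambda>h. D (0, h *s b))) (at z)" by simp
    also have "(\<lambda>h. D (0, h *s b)) = (*) (D (0, b))"
      using c[of _ 0 b] by (simp add: fun_eq_iff mult.commute)
    finally show ?thesis .
  qed
  then show "(\<lambda>z. E a (z *s b)) holomorphic_on S"
    using assms unfolding entire2_def holomorphic_on_def field_differentiable_def has_field_derivative_def
    by (meson has_derivative_at_withinI)
qed

locale dunkl_kernel = root_datum R Rp k
  for R Rp :: "(real ^ 'n) set" and k :: "real ^ 'n \<Rightarrow> real" +
  fixes E :: "complex ^ 'n \<Rightarrow> complex ^ 'n \<Rightarrow> complex"
  assumes kernel: "is_dunkl_kernel Rp k E"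
begin

text \<open>The scalar \<open>c\<close> stays a parameter, because \<open>c = \<i>\<close> is the case of interest while \<open>c = 1\<close> is needed in
\<open>kernel_scale_complex\<close>.\<close>

definition kernel_slice :: "complex \<Rightarrow> real ^ 'n \<Rightarrow> real ^ 'n \<Rightarrow> complex" where
  "kernel_slice c x y = E (cvec x) (c *s cvec y)"

lemma entire: "entire2 E" using kernel by (simp add: is_dunkl_kernel_def)

lemma kernel_eigenfunction: "dunkl_eigenfunction Rp k y (\<lambda>x. E (cvec x) y)"
  using kernel by (simp add: is_dunkl_kernel_def)

lemma slice_0: "kernel_slice c 0 y = 1"
  using kernel_eigenfunction[of "c *s cvec y"] by (simp add: dunkl_eigenfunction_def kernel_slice_def)

lemma slice_has_derivative:
  "((\<lambda>x. kernel_slice c x y) has_derivative frechet_derivative (\<lambda>x. kernel_slice c x y) (at x)) (at x)"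
proof -
  obtain D where D: "((\<lambda>(u, v). E u v) has_derivative D) (at (cvec x, c *s cvec y))"
    using entire unfolding entire2_def by blast
  have "((\<lambda>x. (cvec x, c *s cvec y)) has_derivative (\<lambda>h. (cvec h, 0))) (at x)"
    by (intro has_derivative_Pair has_derivative_cvec has_derivative_const)
  from has_derivative_compose[OF this D] show ?thesis
    by (simp add: kernel_slice_def differentiableI flip: frechet_derivative_works)
qed

lemma slice_equation:
  "frechet_derivative (\<lambda>x. kernel_slice c x y) (at x) \<xi> = c * of_real (\<xi> \<bullet> y) * kernel_slice c x y -
    (\<Sum>\<alpha>\<in>Rp. of_real (k \<alpha>) * of_real (\<alpha> \<bullet> \<xi>) * dunkl_quotient \<alpha> (\<lambda>x. kernel_slice c x y) x)"
proof -
  have "dunkl_operator Rp k \<xi> (\<lambda>x. kernel_slice c x y) x = c * of_real (\<xi> \<bullet> y) * kernel_slice c x y"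
    using kernel_eigenfunction[of "c *s cvec y"]
    by (simp add: dunkl_eigenfunction_def kernel_slice_def cbilinear_cvec)
  then show ?thesis by (simp add: dunkl_operator_def eq_diff_eq)
qed

lemma slice_line_derivative:
  "((\<lambda>s. kernel_slice c (x + s *\<^sub>R \<xi>) y) has_vector_derivative
     frechet_derivative (\<lambda>x. kernel_slice c x y) (at (x + s *\<^sub>R \<xi>)) \<xi>) (at s)"
proof -
  let ?D = "frechet_derivative (\<lambda>x. kernel_slice c x y) (at (x + s *\<^sub>R \<xi>))"
  have "((\<lambda>s. x + s *\<^sub>R \<xi>) has_derivative (\<lambda>h. h *\<^sub>R \<xi>)) (at s)"
    by (auto intro!: derivative_eq_intros)
  from has_derivative_compose[OF this slice_has_derivative]
  have "((\<lambda>s. kernel_slice c (x + s *\<^sub>R \<xi>) y) has_derivative (\<lambda>h. ?D (h *\<^sub>R \<xi>))) (at s)" .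
  moreover have "linear ?D" using slice_has_derivative has_derivative_linear by blast
  ultimately show ?thesis by (simp add: has_vector_derivative_def linear_scale)
qed

text \<open>On the hyperplane \<open>\<alpha> \<bullet> x = 0\<close> both the difference and its coefficient vanish, so the value of the
quotient there is immaterial.\<close>

lemma slice_radial: "radial_equation c y (\<lambda>x. kernel_slice c x y)"
  unfolding radial_equation_def
proof
  fix x
  have q: "of_real (\<alpha> \<bullet> x) * dunkl_quotient \<alpha> (\<lambda>x. kernel_slice c x y) x
      = kernel_slice c x y - kernel_slice c (reflection \<alpha> x) y" for \<alpha>
    by (simp add: dunkl_quotient_def reflection_def)
  show "((\<lambda>t. kernel_slice c (t *\<^sub>R x) y) has_vector_derivative
      c * of_real (x \<bullet> y) * kernel_slice c x y -
      (\<Sum>\<alpha>\<in>Rp. of_real (k \<alpha>) * (kernel_slice c x y - kernel_slice c (reflection \<alpha> x) y))) (at 1)"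
    using slice_line_derivative[of c 0 x y 1] by (simp add: slice_equation mult.assoc q)
qed

lemma slice_ray_continuous: "continuous_on S (\<lambda>t. kernel_slice c (t *\<^sub>R x) y)"
  using slice_line_derivative[of c 0 x y]
  by (intro continuous_at_imp_continuous_on ballI has_vector_derivative_continuous) simp

lemma slice_unique:
  assumes "radial_equation c y f" "f 0 = 1" "\<And>x. continuous_on {0..} (\<lambda>t. f (t *\<^sub>R x))"
  shows "f x = kernel_slice c x y"
  using radial_equation_unique[OF assms(1) slice_radial _ assms(3) slice_ray_continuous]
  by (simp add: assms(2) slice_0 fun_eq_iff)

lemma slice_scale: "kernel_slice c (t *\<^sub>R x) y = kernel_slice c x (t *\<^sub>R y)"
proof (rule slice_unique[where f = "\<lambda>x. kernel_slice c (t *\<^sub>R x) y"])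
  show "radial_equation c (t *\<^sub>R y) (\<lambda>x. kernel_slice c (t *\<^sub>R x) y)"
    unfolding radial_equation_def
  proof
    fix x
    show "((\<lambda>s. kernel_slice c (t *\<^sub>R (s *\<^sub>R x)) y) has_vector_derivative
      c * of_real (x \<bullet> t *\<^sub>R y) * kernel_slice c (t *\<^sub>R x) y -
      (\<Sum>\<alpha>\<in>Rp. of_real (k \<alpha>) * (kernel_slice c (t *\<^sub>R x) y - kernel_slice c (t *\<^sub>R reflection \<alpha> x) y))) (at 1)"
      using slice_radial[of c y, unfolded radial_equation_def, rule_format, of "t *\<^sub>R x"]
      by (simp add: linear_scale[OF linear_reflection] mult.commute[of t])
  qed
  show "continuous_on {0..} (\<lambda>s. kernel_slice c (t *\<^sub>R (s *\<^sub>R x)) y)" for x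
    using slice_ray_continuous[of "{0..}" c "t *\<^sub>R x" y] by (simp add: mult.commute[of t])
qed (simp add: slice_0)

lemma slice_invariant:
  assumes g: "g \<in> G"
  shows "kernel_slice c (g x) (g y) = kernel_slice c x y"
proof (rule slice_unique[where f = "\<lambda>x. kernel_slice c (g x) (g y)"])
  show "radial_equation c y (\<lambda>x. kernel_slice c (g x) (g y))"
    unfolding radial_equation_def
  proof
    fix x
    have "(\<Sum>\<alpha>\<in>Rp. of_real (k \<alpha>) * (kernel_slice c (g x) (g y) - kernel_slice c (g (reflection \<alpha> x)) (g y)))
      = (\<Sum>\<alpha>\<in>Rp. of_real (k (g \<alpha>)) * (kernel_slice c (g x) (g y) - kernel_slice c (reflection (g \<alpha>) (g x)) (g y)))"
      using Rp_subset by (intro sum.cong)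
        (auto simp: multiplicity_invariant g group_conjugates_reflection subset_iff)
    also have "\<dots> = (\<Sum>\<alpha>\<in>Rp. of_real (k \<alpha>) * (kernel_slice c (g x) (g y) - kernel_slice c (reflection \<alpha> (g x)) (g y)))"
      by (rule sum_positive_roots_invariant[OF g]) (simp add: multiplicity_uminus reflection_def)
    finally show "((\<lambda>t. kernel_slice c (g (t *\<^sub>R x)) (g y)) has_vector_derivative
      c * of_real (x \<bullet> y) * kernel_slice c (g x) (g y) -
      (\<Sum>\<alpha>\<in>Rp. of_real (k \<alpha>) * (kernel_slice c (g x) (g y) - kernel_slice c (g (reflection \<alpha> x)) (g y)))) (at 1)"
      using slice_radial[of c "g y", unfolded radial_equation_def, rule_format, of "g x"]
      by (simp add: group_scale[OF g] group_inner[OF g])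
  qed
qed (simp_all add: linear_0[OF group_linear[OF g]] slice_0 group_scale[OF g] slice_ray_continuous)

text \<open>By homogeneity, moving \<open>y\<close> radially in the second argument is the same as moving \<open>x\<close> radially in the
first one, and by invariance the reflections may be moved from one argument to the other. So the radial
equation in the first argument is also the radial equation in the second one, and uniqueness applies.\<close>

lemma slice_symmetric: "kernel_slice c x y = kernel_slice c y x"
proof (rule slice_unique[where f = "\<lambda>y. kernel_slice c x y"])
  show "radial_equation c x (\<lambda>y. kernel_slice c x y)"
    unfolding radial_equation_def
  proof
    fix y
    have "kernel_slice c x (reflection \<alpha> y) = kernel_slice c (reflection \<alpha> x) y" if "\<alpha> \<in> Rp" for \<alpha>
    proof -
      have "\<alpha> \<in> R" using that Rp_subset by auto
      then show ?thesis
        using slice_invariant[OF reflection_group.reflection, of \<alpha> c x "reflection \<alpha> y"]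
        by (simp add: reflection_reflection)
    qed
    then show "((\<lambda>t. kernel_slice c x (t *\<^sub>R y)) has_vector_derivative
      c * of_real (y \<bullet> x) * kernel_slice c x y -
      (\<Sum>\<alpha>\<in>Rp. of_real (k \<alpha>) * (kernel_slice c x y - kernel_slice c x (reflection \<alpha> y)))) (at 1)"
      using slice_radial[of c y, unfolded radial_equation_def, rule_format, of x]
      by (simp add: inner_commute[of y] flip: slice_scale)
  qed
  show "kernel_slice c x 0 = 1"
    using slice_scale[of c 0 x y] by (simp add: slice_0)
  show "continuous_on {0..} (\<lambda>t. kernel_slice c x (t *\<^sub>R y))" for y
    by (simp add: slice_ray_continuous flip: slice_scale)
qed

text \<open>For real \<open>z\<close> this is homogeneity of the kernel on real arguments; both sides are entire in \<open>z\<close>. It moves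
the imaginary unit to the second argument, where the eigenvalue equation is known.\<close>

lemma kernel_scale_complex: "E (z *s cvec x) (cvec y) = kernel_slice z x y"
proof -
  define h where "h = (\<lambda>z. E (z *s cvec x) (cvec y) - E (cvec x) (z *s cvec y))"
  have "h z = 0"
  proof (rule analytic_continuation[of h UNIV "range (of_real :: real \<Rightarrow> complex)" 0])
    show "h holomorphic_on UNIV"
      unfolding h_def by (intro holomorphic_intros entire2_holomorphic_in_scalar entire)
    show "h z = 0" if z: "z \<in> range (of_real :: real \<Rightarrow> complex)" for z
    proof -
      obtain t :: real where "z = of_real t" using z by auto
      then show ?thesis using slice_scale[of 1 t x y] by (simp add: h_def kernel_slice_def cvec_scale)
    qed
    show "(0::complex) islimpt range (of_real :: real \<Rightarrow> complex)"
      unfolding islimpt_approachable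
    proof (intro allI impI)
      fix e :: real assume "0 < e"
      then show "\<exists>x'\<in>range (of_real :: real \<Rightarrow> complex). x' \<noteq> 0 \<and> dist x' (0::complex) < e"
        by (intro bexI[of _ "of_real (e / 2)"] rangeI conjI) simp_all
    qed
  qed (simp_all add: connected_UNIV)
  then show ?thesis by (simp add: h_def kernel_slice_def)
qed

end

section \<open>Linear systems with slowly decaying oscillating coefficients\<close>

lemma finite_positive_lower_bound:
  fixes f :: "'a \<Rightarrow> real"
  assumes "finite A" "\<And>a. a \<in> A \<Longrightarrow> 0 < f a"
  obtains r where "0 < r" "\<And>a. a \<in> A \<Longrightarrow> r \<le> f a"
proof
  show "0 < Min (insert 1 (f ` A))" using assms by (subst Min_gr_iff) auto
  show "Min (insert 1 (f ` A)) \<le> f a" if "a \<in> A" for a using assms that by (intro Min_le) auto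
qed

lemma tendsto_of_inverse_bound:
  fixes f :: "real \<Rightarrow> complex"
  assumes t0: "0 < t0" and bd: "\<And>t s. t0 \<le> t \<Longrightarrow> t \<le> s \<Longrightarrow> norm (f s - f t) \<le> B / t"
  obtains L where "(f \<longlongrightarrow> L) at_top" "\<And>t. t0 \<le> t \<Longrightarrow> norm (f t - L) \<le> B / t"
proof -
  have B: "0 \<le> B" using bd[of t0 t0] t0 by (simp add: zero_le_divide_iff)
  have small: "eventually (\<lambda>t. B / t < e) at_top" if "0 < e" for e
    using order_tendstoD(2)[OF tendsto_divide_0[OF tendsto_const filterlim_at_top_imp_at_infinity[OF filterlim_ident]] that] .
  have "Cauchy (\<lambda>n. f (real n))"
    unfolding Cauchy_altdef2
  proof (intro allI impI)
    fix e :: real assume "0 < e"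
    then have "eventually (\<lambda>n. t0 \<le> real n \<and> B / real n < e) sequentially"
      by (intro eventually_conj eventually_compose_filterlim[OF small filterlim_real_sequentially]
          eventually_compose_filterlim[OF eventually_ge_at_top filterlim_real_sequentially])
    then obtain n where n: "t0 \<le> real n" "B / real n < e" by (auto simp: eventually_sequentially)
    have "dist (f (real m)) (f (real n)) < e" if "n \<le> m" for m
      using bd[OF n(1), of "real m"] n(2) that by (simp add: dist_norm)
    then show "\<exists>N. \<forall>n\<ge>N. dist (f (real n)) (f (real N)) < e" by blast
  qed
  then obtain L where L: "(\<lambda>n. f (real n)) \<longlonglongrightarrow> L" using Cauchy_convergent convergent_def by blast
  have bound: "norm (f t - L) \<le> B / t" if "t0 \<le> t" for t
  proof (rule tendsto_upperbound)
    show "(\<lambda>n. norm (f t - f (real n))) \<longlonglongrightarrow> norm (f t - L)" by (intro tendsto_intros L)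
    have "eventually (\<lambda>n. t \<le> real n) sequentially"
      by (rule eventually_compose_filterlim[OF eventually_ge_at_top filterlim_real_sequentially])
    then show "eventually (\<lambda>n. norm (f t - f (real n)) \<le> B / t) sequentially"
      by (rule eventually_mono) (metis bd norm_minus_commute that)
  qed simp
  have "((\<lambda>t. f t - L) \<longlongrightarrow> 0) at_top"
    by (rule Lim_null_comparison[where g = "\<lambda>t. B / t"])
      (auto intro: eventually_mono[OF eventually_ge_at_top[of t0]] bound
        tendsto_divide_0[OF tendsto_const filterlim_at_top_imp_at_infinity[OF filterlim_ident]])
  then show ?thesis using that[of L] bound by (simp add: LIM_zero_iff)
qed

text \<open>The coefficients of the system decay only like \<open>1 / \<theta>\<close> and are not integrable, but they oscillate.
Subtracting from \<open>F\<close> the terms \<open>k \<alpha> * q \<alpha> g * F (act \<alpha> g)\<close>, where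
\<open>q = \<i> cis (- \<theta> c) / (c \<theta>)\<close> is an approximate primitive of \<open>\<theta>' cis (- \<theta> c) / \<theta>\<close>, cancels them: the
corrected function has a derivative of size \<open>\<theta>' / \<theta>^2\<close> times the size of \<open>F\<close>, and the correction itself
has size \<open>1 / \<theta>\<close>. The function \<open>\<phi>\<close> measures the integral of \<open>\<theta>' / \<theta>^2\<close> along the path. The supremum of
\<open>F\<close> over the path is absorbed at the end by the smallness of \<open>\<epsilon>\<close>.\<close>

lemma oscillatory_system_estimate:
  fixes F :: "'g \<Rightarrow> real \<Rightarrow> complex" and \<theta> \<theta>' :: "'a \<Rightarrow> real \<Rightarrow> real"
  assumes finG: "finite G" and finA: "finite A"
    and act: "\<And>\<alpha> g. \<alpha> \<in> A \<Longrightarrow> g \<in> G \<Longrightarrow> act \<alpha> g \<in> G"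
    and k: "\<And>\<alpha>. \<alpha> \<in> A \<Longrightarrow> 0 \<le> k \<alpha>"
    and ab: "a \<le> b"
    and F: "\<And>g s. g \<in> G \<Longrightarrow> a \<le> s \<Longrightarrow> s \<le> b \<Longrightarrow> (F g has_vector_derivative
       (\<Sum>\<alpha>\<in>A. of_real (k \<alpha> * (\<theta>' \<alpha> s / \<theta> \<alpha> s)) * cis (- (\<theta> \<alpha> s * c \<alpha> g)) * F (act \<alpha> g) s)) (at s)"
    and \<theta>: "\<And>\<alpha> s. \<alpha> \<in> A \<Longrightarrow> a \<le> s \<Longrightarrow> s \<le> b \<Longrightarrow> (\<theta> \<alpha> has_real_derivative \<theta>' \<alpha> s) (at s)"
    and r: "0 < r" "\<And>\<alpha> s. \<alpha> \<in> A \<Longrightarrow> a \<le> s \<Longrightarrow> s \<le> b \<Longrightarrow> r \<le> \<theta> \<alpha> s"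
    and \<phi>: "\<And>s. a \<le> s \<Longrightarrow> s \<le> b \<Longrightarrow> (\<phi> has_real_derivative \<phi>' s) (at s)"
    and \<phi>0: "\<And>s. a \<le> s \<Longrightarrow> s \<le> b \<Longrightarrow> 0 \<le> \<phi>' s"
    and \<phi>': "\<And>\<alpha> \<beta> s. \<alpha> \<in> A \<Longrightarrow> \<beta> \<in> A \<Longrightarrow> a \<le> s \<Longrightarrow> s \<le> b \<Longrightarrow> \<bar>\<theta>' \<beta> s\<bar> / (\<theta> \<beta> s * \<theta> \<alpha> s) \<le> \<phi>' s"
    and c0: "0 < c0" "\<And>\<alpha> g. \<alpha> \<in> A \<Longrightarrow> g \<in> G \<Longrightarrow> c0 \<le> \<bar>c \<alpha> g\<bar>"
    and \<epsilon>: "(sum k A * (1 + sum k A) * (\<phi> b - \<phi> a) + 2 * sum k A / r) / c0 \<le> \<epsilon>" "\<epsilon> \<le> 1 / 2"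
    and N: "\<And>g. g \<in> G \<Longrightarrow> norm (F g a) \<le> N"
    and g: "g \<in> G"
  shows "norm (F g b - F g a) \<le> 2 * \<epsilon> * N"
proof -
  define K where "K = sum k A"
  have K: "0 \<le> K" unfolding K_def by (intro sum_nonneg k)
  have cont: "continuous_on {a..b} (F g)" if "g \<in> G" for g
    using F[OF that] by (intro continuous_at_imp_continuous_on ballI has_vector_derivative_continuous) auto
  have "\<forall>g\<in>G. \<exists>s\<in>{a..b}. \<forall>s'\<in>{a..b}. norm (F g s') \<le> norm (F g s)"
    using ab by (intro ballI continuous_attains_sup continuous_on_norm cont) auto
  then obtain \<sigma> where \<sigma>: "\<And>g. g \<in> G \<Longrightarrow> \<sigma> g \<in> {a..b}"
      "\<And>g s. g \<in> G \<Longrightarrow> s \<in> {a..b} \<Longrightarrow> norm (F g s) \<le> norm (F g (\<sigma> g))"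
    by metis
  define S where "S = Max ((\<lambda>g. norm (F g (\<sigma> g))) ` G)"
  have "S \<in> (\<lambda>g. norm (F g (\<sigma> g))) ` G" unfolding S_def using finG g by (intro Max_in) auto
  then obtain g0 where g0: "g0 \<in> G" "S = norm (F g0 (\<sigma> g0))" by auto
  have S: "norm (F g s) \<le> S" if "g \<in> G" "a \<le> s" "s \<le> b" for g s
  proof -
    have "norm (F g (\<sigma> g)) \<le> S" unfolding S_def using finG that by (intro Max_ge) auto
    then show ?thesis using \<sigma>(2)[of g s] that by simp
  qed
  have S0: "0 \<le> S" using g0 by simp
  define q where "q = (\<lambda>\<alpha> g s. \<i> * cis (- (\<theta> \<alpha> s * c \<alpha> g)) / of_real (c \<alpha> g * \<theta> \<alpha> s))"
  define F' where "F' = (\<lambda>g s. \<Sum>\<alpha>\<in>A. of_real (k \<alpha> * (\<theta>' \<alpha> s / \<theta> \<alpha> s)) * cis (- (\<theta> \<alpha> s * c \<alpha> g)) * F (act \<alpha> g) s)"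
  define C where "C = (\<lambda>g s. \<Sum>\<alpha>\<in>A. of_real (k \<alpha>) * (q \<alpha> g s * F (act \<alpha> g) s))"
  \<comment> \<open>The derivative of the corrected function: the leading part of the derivative of \<open>q\<close> has cancelled
     against the system.\<close>
  define H' where "H' = (\<lambda>g s. \<Sum>\<alpha>\<in>A. of_real (k \<alpha>) *
     (\<i> * cis (- (\<theta> \<alpha> s * c \<alpha> g)) * of_real (\<theta>' \<alpha> s / (c \<alpha> g * (\<theta> \<alpha> s * \<theta> \<alpha> s))) * F (act \<alpha> g) s
       - q \<alpha> g s * F' (act \<alpha> g) s))"
  have cnz: "c \<alpha> g \<noteq> 0" if "\<alpha> \<in> A" "g \<in> G" for \<alpha> g using c0(1) c0(2)[OF that] by auto
  have \<theta>pos: "0 < \<theta> \<alpha> s" if "\<alpha> \<in> A" "a \<le> s" "s \<le> b" for \<alpha> s using r(1) r(2)[OF that] by simp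
  have q_norm: "norm (q \<alpha> g s) \<le> 1 / (c0 * \<theta> \<alpha> s)" if "\<alpha> \<in> A" "g \<in> G" "a \<le> s" "s \<le> b" for \<alpha> g s
  proof -
    have "c0 * \<theta> \<alpha> s \<le> \<bar>c \<alpha> g\<bar> * \<theta> \<alpha> s" using c0(2) \<theta>pos that by (intro mult_right_mono) (auto simp: less_imp_le)
    then show ?thesis using c0(1) \<theta>pos[of \<alpha> s] that
      by (simp add: q_def norm_mult norm_divide abs_mult frac_le)
  qed
  have q_deriv: "(q \<alpha> g has_vector_derivative
      cis (- (\<theta> \<alpha> s * c \<alpha> g)) * of_real (\<theta>' \<alpha> s / \<theta> \<alpha> s)
      - \<i> * cis (- (\<theta> \<alpha> s * c \<alpha> g)) * of_real (\<theta>' \<alpha> s / (c \<alpha> g * (\<theta> \<alpha> s * \<theta> \<alpha> s)))) (at s)"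
    if A: "\<alpha> \<in> A" "g \<in> G" "a \<le> s" "s \<le> b" for \<alpha> g s
  proof -
    define Q where "Q = (\<lambda>z. \<i> * exp (- (\<i> * (z * of_real (c \<alpha> g)))) / (of_real (c \<alpha> g) * z))"
    define z where "z = complex_of_real (\<theta> \<alpha> s)"
    have z: "z \<noteq> 0" using \<theta>pos[of \<alpha> s] A by (simp add: z_def)
    define Q' where "Q' = exp (- (\<i> * (z * of_real (c \<alpha> g)))) / z - \<i> * exp (- (\<i> * (z * of_real (c \<alpha> g)))) / (of_real (c \<alpha> g) * (z * z))"
    have "(Q has_field_derivative Q') (at z)"
      unfolding Q_def Q'_def using cnz[OF A(1,2)] z
      by (auto intro!: derivative_eq_intros simp: field_simps)
    moreover have "((\<lambda>s. of_real (\<theta> \<alpha> s)) has_vector_derivative of_real (\<theta>' \<alpha> s)) (at s)"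
      using \<theta>[OF A(1,3,4)] by (simp add: has_vector_derivative_of_real has_real_derivative_iff_has_vector_derivative)
    ultimately have "((\<lambda>s. Q (of_real (\<theta> \<alpha> s))) has_vector_derivative of_real (\<theta>' \<alpha> s) * Q') (at s)"
      using field_vector_diff_chain_at[of "\<lambda>s. of_real (\<theta> \<alpha> s)" _ s Q Q'] by (simp add: z_def o_def)
    moreover have "(\<lambda>s. Q (of_real (\<theta> \<alpha> s))) = q \<alpha> g"
      by (simp add: Q_def q_def fun_eq_iff cis_conv_exp)
    moreover have "of_real (\<theta>' \<alpha> s) * Q' = cis (- (\<theta> \<alpha> s * c \<alpha> g)) * of_real (\<theta>' \<alpha> s / \<theta> \<alpha> s)
      - \<i> * cis (- (\<theta> \<alpha> s * c \<alpha> g)) * of_real (\<theta>' \<alpha> s / (c \<alpha> g * (\<theta> \<alpha> s * \<theta> \<alpha> s)))"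
      by (simp add: Q'_def z_def cis_conv_exp right_diff_distrib mult_ac)
    ultimately show ?thesis by simp
  qed
  have H_deriv: "((\<lambda>s. F g s - C g s) has_vector_derivative H' g s) (at s)"
    if "g \<in> G" "a \<le> s" "s \<le> b" for g s
  proof -
    have FF: "(F g has_vector_derivative F' g s) (at s)" if "g \<in> G" for g
      unfolding F'_def by (rule F) (use that \<open>a \<le> s\<close> \<open>s \<le> b\<close> in auto)
    have F'_g: "F' g s = (\<Sum>\<alpha>\<in>A. of_real (k \<alpha> * (\<theta>' \<alpha> s / \<theta> \<alpha> s)) * cis (- (\<theta> \<alpha> s * c \<alpha> g)) * F (act \<alpha> g) s)"
      by (simp only: F'_def)
    have "((\<lambda>s. of_real (k \<alpha>) * (q \<alpha> g s * F (act \<alpha> g) s)) has_vector_derivative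
       of_real (k \<alpha>) * (q \<alpha> g s * F' (act \<alpha> g) s +
      (cis (- (\<theta> \<alpha> s * c \<alpha> g)) * of_real (\<theta>' \<alpha> s / \<theta> \<alpha> s)
      - \<i> * cis (- (\<theta> \<alpha> s * c \<alpha> g)) * of_real (\<theta>' \<alpha> s / (c \<alpha> g * (\<theta> \<alpha> s * \<theta> \<alpha> s)))) * F (act \<alpha> g) s)) (at s)"
      if "\<alpha> \<in> A" for \<alpha>
      by (intro has_vector_derivative_mult_right has_vector_derivative_mult q_deriv FF act that
        \<open>a \<le> s\<close> \<open>s \<le> b\<close> \<open>g \<in> G\<close>)
    then have "((\<lambda>s. F g s - C g s) has_vector_derivative (F' g s - (\<Sum>\<alpha>\<in>A. of_real (k \<alpha>) * (q \<alpha> g s * F' (act \<alpha> g) s +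
      (cis (- (\<theta> \<alpha> s * c \<alpha> g)) * of_real (\<theta>' \<alpha> s / \<theta> \<alpha> s)
      - \<i> * cis (- (\<theta> \<alpha> s * c \<alpha> g)) * of_real (\<theta>' \<alpha> s / (c \<alpha> g * (\<theta> \<alpha> s * \<theta> \<alpha> s)))) * F (act \<alpha> g) s)))) (at s)"
      unfolding C_def by (intro has_vector_derivative_diff has_vector_derivative_sum FF that(1))
    moreover have "F' g s - (\<Sum>\<alpha>\<in>A. of_real (k \<alpha>) * (q \<alpha> g s * F' (act \<alpha> g) s +
      (cis (- (\<theta> \<alpha> s * c \<alpha> g)) * of_real (\<theta>' \<alpha> s / \<theta> \<alpha> s)
      - \<i> * cis (- (\<theta> \<alpha> s * c \<alpha> g)) * of_real (\<theta>' \<alpha> s / (c \<alpha> g * (\<theta> \<alpha> s * \<theta> \<alpha> s)))) * F (act \<alpha> g) s)) = H' g s"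
      unfolding H'_def F'_g sum_subtractf[symmetric]
      by (intro sum.cong) (simp_all add: algebra_simps)
    ultimately show ?thesis by simp
  qed
  have F'_bound: "norm (q \<alpha> h s * F' g s) \<le> K * \<phi>' s * S / c0"
    if A: "\<alpha> \<in> A" "g \<in> G" "h \<in> G" "a \<le> s" "s \<le> b" for \<alpha> g h s
  proof -
    have "norm (F' g s) \<le> (\<Sum>\<beta>\<in>A. k \<beta> * (\<bar>\<theta>' \<beta> s\<bar> / \<theta> \<beta> s) * S)"
      unfolding F'_def
    proof (rule sum_norm_le)
      fix \<beta> assume B: "\<beta> \<in> A"
      have "k \<beta> * (\<bar>\<theta>' \<beta> s\<bar> / \<theta> \<beta> s) * norm (F (act \<beta> g) s) \<le> k \<beta> * (\<bar>\<theta>' \<beta> s\<bar> / \<theta> \<beta> s) * S"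
        using k[OF B] \<theta>pos[OF B A(4,5)] act[OF B A(2)] S A by (intro mult_left_mono) auto
      then show "norm (of_real (k \<beta> * (\<theta>' \<beta> s / \<theta> \<beta> s)) * cis (- (\<theta> \<beta> s * c \<beta> g)) * F (act \<beta> g) s)
          \<le> k \<beta> * (\<bar>\<theta>' \<beta> s\<bar> / \<theta> \<beta> s) * S"
        using k[OF B] \<theta>pos[OF B A(4,5)] by (simp add: norm_mult norm_divide abs_mult)
    qed
    then have "norm (q \<alpha> h s * F' g s) \<le> 1 / (c0 * \<theta> \<alpha> s) * (\<Sum>\<beta>\<in>A. k \<beta> * (\<bar>\<theta>' \<beta> s\<bar> / \<theta> \<beta> s) * S)"
      unfolding norm_mult using q_norm[of \<alpha> h s] A c0(1) \<theta>pos[of \<alpha> s] by (intro mult_mono) auto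
    also have "\<dots> = (\<Sum>\<beta>\<in>A. k \<beta> * (\<bar>\<theta>' \<beta> s\<bar> / (\<theta> \<beta> s * \<theta> \<alpha> s)) * (S / c0))"
      unfolding sum_distrib_left by (intro sum.cong) (auto simp: field_simps)
    also have "\<dots> \<le> (\<Sum>\<beta>\<in>A. k \<beta> * \<phi>' s * (S / c0))"
      using k \<phi>' A S0 c0(1) by (intro sum_mono mult_right_mono mult_left_mono) auto
    also have "\<dots> = K * \<phi>' s * S / c0" by (simp add: K_def sum_distrib_right sum_divide_distrib)
    finally show ?thesis .
  qed
  have H'_bound: "norm (H' g s) \<le> K * (1 + K) * S / c0 * \<phi>' s" if A: "g \<in> G" "a \<le> s" "s \<le> b" for g s
  proof -
    have "norm (H' g s) \<le> (\<Sum>\<alpha>\<in>A. k \<alpha> * (\<phi>' s * S / c0 + K * \<phi>' s * S / c0))"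
      unfolding H'_def
    proof (rule sum_norm_le)
      fix \<alpha> assume B: "\<alpha> \<in> A"
      note t = \<theta>pos[OF B A(2,3)]
      have "norm (\<i> * cis (- (\<theta> \<alpha> s * c \<alpha> g)) * of_real (\<theta>' \<alpha> s / (c \<alpha> g * (\<theta> \<alpha> s * \<theta> \<alpha> s))) * F (act \<alpha> g) s)
        = (\<bar>\<theta>' \<alpha> s\<bar> / (\<theta> \<alpha> s * \<theta> \<alpha> s)) * (norm (F (act \<alpha> g) s) / \<bar>c \<alpha> g\<bar>)"
        using t by (simp add: norm_mult norm_divide abs_mult)
      also have "\<dots> \<le> \<phi>' s * (S / c0)"
        using t \<phi>'[OF B B A(2,3)] \<phi>0[OF A(2,3)] S[OF act[OF B A(1)] A(2,3)] S0 c0(1) c0(2)[OF B A(1)]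
        by (intro mult_mono frac_le) auto
      finally have "norm (\<i> * cis (- (\<theta> \<alpha> s * c \<alpha> g)) * of_real (\<theta>' \<alpha> s / (c \<alpha> g * (\<theta> \<alpha> s * \<theta> \<alpha> s))) * F (act \<alpha> g) s
        - q \<alpha> g s * F' (act \<alpha> g) s) \<le> \<phi>' s * S / c0 + K * \<phi>' s * S / c0"
        using F'_bound[OF B act[OF B A(1)] A] by (intro norm_triangle_le_diff add_mono) simp_all
      then show "norm (of_real (k \<alpha>) * (\<i> * cis (- (\<theta> \<alpha> s * c \<alpha> g)) * of_real (\<theta>' \<alpha> s / (c \<alpha> g * (\<theta> \<alpha> s * \<theta> \<alpha> s))) * F (act \<alpha> g) s
        - q \<alpha> g s * F' (act \<alpha> g) s)) \<le> k \<alpha> * (\<phi>' s * S / c0 + K * \<phi>' s * S / c0)"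
        using k[OF B] by (simp only: norm_mult norm_of_real abs_of_nonneg mult_left_mono)
    qed
    also have "\<dots> = K * (\<phi>' s * S / c0 + K * \<phi>' s * S / c0)" by (simp only: K_def sum_distrib_right)
    also have "\<dots> = K * (1 + K) * S / c0 * \<phi>' s" using c0(1) by (simp add: field_simps)
    finally show ?thesis .
  qed
  have C_bound: "norm (C g s) \<le> K * S / (r * c0)" if A: "g \<in> G" "a \<le> s" "s \<le> b" for g s
  proof -
    have "norm (C g s) \<le> (\<Sum>\<alpha>\<in>A. k \<alpha> * (1 / (c0 * r) * S))"
      unfolding C_def
    proof (rule sum_norm_le)
      fix \<alpha> assume B: "\<alpha> \<in> A"
      have "norm (q \<alpha> g s) \<le> 1 / (c0 * r)"
        using q_norm[OF B A] c0(1) r(1) r(2)[OF B A(2,3)]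
        by (elim order.trans) (intro divide_left_mono mult_left_mono, auto)
      then have "norm (q \<alpha> g s * F (act \<alpha> g) s) \<le> 1 / (c0 * r) * S"
        unfolding norm_mult using S[OF act[OF B A(1)] A(2,3)] c0(1) r(1) by (intro mult_mono) auto
      then show "norm (of_real (k \<alpha>) * (q \<alpha> g s * F (act \<alpha> g) s)) \<le> k \<alpha> * (1 / (c0 * r) * S)"
        using k[OF B] by (simp only: norm_mult[of "of_real _"] norm_of_real abs_of_nonneg mult_left_mono)
    qed
    also have "\<dots> = K * (1 / (c0 * r) * S)" by (simp only: K_def sum_distrib_right)
    also have "\<dots> = K * S / (r * c0)" by (simp add: field_simps)
    finally show ?thesis .
  qed
  have main: "norm (F g s - F g a) \<le> \<epsilon> * S" if A: "g \<in> G" "a \<le> s" "s \<le> b" for g s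
  proof -
    have H: "norm ((F g s - C g s) - (F g a - C g a)) \<le> K * (1 + K) * S / c0 * \<phi> s - K * (1 + K) * S / c0 * \<phi> a"
    proof (cases "a = s")
      case False
      show ?thesis
      proof (rule differentiable_bound_general[where f' = "H' g" and \<phi>' = "\<lambda>s. K * (1 + K) * S / c0 * \<phi>' s"])
        show "continuous_on {a..s} (\<lambda>s. F g s - C g s)"
          using A by (intro continuous_at_imp_continuous_on ballI has_vector_derivative_continuous[OF H_deriv]) auto
        have d: "((\<lambda>s. K * (1 + K) * S / c0 * \<phi> s) has_vector_derivative K * (1 + K) * S / c0 * \<phi>' u) (at u)"
          if "a \<le> u" "u \<le> b" for u
          by (intro has_vector_derivative_mult_right)
            (use \<phi> that in \<open>simp add: has_real_derivative_iff_has_vector_derivative\<close>)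
        show "continuous_on {a..s} (\<lambda>s. K * (1 + K) * S / c0 * \<phi> s)"
          using A by (intro continuous_at_imp_continuous_on ballI has_vector_derivative_continuous[OF d]) auto
        show "((\<lambda>s. K * (1 + K) * S / c0 * \<phi> s) has_vector_derivative K * (1 + K) * S / c0 * \<phi>' u) (at u)"
          if "a < u" "u < s" for u using d that A by auto
      qed (use A False H_deriv H'_bound in auto)
    qed simp
    have "\<phi> s \<le> \<phi> b"
      by (rule DERIV_nonneg_imp_nondecreasing[OF A(3)]) (use \<phi> \<phi>0 A in \<open>meson order.trans\<close>)
    then have "K * (1 + K) * S / c0 * (\<phi> s - \<phi> a) \<le> K * (1 + K) * S / c0 * (\<phi> b - \<phi> a)"
      using K S0 c0(1) by (intro mult_left_mono) auto
    then have H_bound: "norm ((F g s - C g s) - (F g a - C g a)) \<le> K * (1 + K) * S / c0 * (\<phi> b - \<phi> a)"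
      by (intro order.trans[OF H]) (simp only: right_diff_distrib)
    have "F g s - F g a = ((F g s - C g s) - (F g a - C g a)) + C g s - C g a" by simp
    then have "norm (F g s - F g a) \<le> norm ((F g s - C g s) - (F g a - C g a)) + norm (C g s) + norm (C g a)"
      using norm_triangle_ineq4[of "((F g s - C g s) - (F g a - C g a)) + C g s" "C g a"]
        norm_triangle_ineq[of "((F g s - C g s) - (F g a - C g a))" "C g s"] by simp
    also have "\<dots> \<le> K * (1 + K) * S / c0 * (\<phi> b - \<phi> a) + K * S / (r * c0) + K * S / (r * c0)"
      by (intro add_mono H_bound C_bound A order_refl ab)
    also have "\<dots> = (K * (1 + K) * (\<phi> b - \<phi> a) + 2 * K / r) / c0 * S"
      using c0(1) r(1) by (simp add: field_simps)
    also have "\<dots> \<le> \<epsilon> * S" using \<epsilon>(1) S0 by (intro mult_right_mono) (simp_all add: K_def)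
    finally show ?thesis .
  qed
  have \<epsilon>0: "0 \<le> \<epsilon>"
  proof -
    have "\<phi> a \<le> \<phi> b"
      by (rule DERIV_nonneg_imp_nondecreasing[OF ab]) (use \<phi> \<phi>0 in blast)
    then have "0 \<le> (sum k A * (1 + sum k A) * (\<phi> b - \<phi> a) + 2 * sum k A / r) / c0"
      using K c0(1) r(1) by (intro divide_nonneg_pos add_nonneg_nonneg mult_nonneg_nonneg) (auto simp: K_def)
    then show ?thesis using \<epsilon>(1) by simp
  qed
  have "S \<le> N + \<epsilon> * S"
    using main[OF g0(1), of "\<sigma> g0"] \<sigma>(1)[OF g0(1)] N[OF g0(1)] norm_triangle_sub[of "F g0 (\<sigma> g0)" "F g0 a"]
    by (simp add: g0(2))
  moreover have "\<epsilon> * S \<le> 1 / 2 * S" using \<epsilon>(2) S0 by (intro mult_right_mono) auto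
  ultimately have "S \<le> 2 * N" by simp
  then have "\<epsilon> * S \<le> \<epsilon> * (2 * N)" using \<epsilon>0 by (intro mult_left_mono)
  then show ?thesis using main[OF g ab] by simp
qed

section \<open>The differential system of the normalized kernel\<close>

context dunkl_kernel
begin

abbreviation C where "C \<equiv> weyl_chamber Rp"

text \<open>On the chamber the square root of the weight is the exponential of this sum; the logarithmic form has a
simple derivative and makes the scaling behaviour additive.\<close>

definition log_sqrt_weight :: "real ^ 'n \<Rightarrow> real" where
  "log_sqrt_weight x = (\<Sum>\<alpha>\<in>Rp. k \<alpha> * ln (\<alpha> \<bullet> x))"

lemma chamber_pos: "x \<in> C \<Longrightarrow> \<alpha> \<in> Rp \<Longrightarrow> 0 < \<alpha> \<bullet> x"
  by (simp add: weyl_chamber_def)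

lemma dunkl_weight_chamber:
  assumes "x \<in> C"
  shows "dunkl_weight Rp k x = exp (2 * log_sqrt_weight x)"
proof -
  have "dunkl_weight Rp k x = (\<Prod>\<alpha>\<in>Rp. exp (2 * (k \<alpha> * ln (\<alpha> \<bullet> x))))"
    unfolding dunkl_weight_def using chamber_pos[OF assms]
    by (intro prod.cong) (auto simp: powr_def abs_of_pos less_imp_neq[symmetric])
  then show ?thesis by (simp add: log_sqrt_weight_def exp_sum finite_Rp sum_distrib_left)
qed

lemma sqrt_weight_chamber:
  assumes "x \<in> C" "y \<in> C"
  shows "sqrt (dunkl_weight Rp k x * dunkl_weight Rp k y) = exp (log_sqrt_weight x + log_sqrt_weight y)"
proof -
  have "dunkl_weight Rp k x * dunkl_weight Rp k y = (exp (log_sqrt_weight x + log_sqrt_weight y))\<^sup>2"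
    by (simp add: dunkl_weight_chamber assms power2_eq_square flip: exp_add)
  then show ?thesis by simp
qed

lemma log_sqrt_weight_scale:
  assumes "x \<in> C" "0 < t"
  shows "log_sqrt_weight (t *\<^sub>R x) = \<kappa> * ln t + log_sqrt_weight x"
proof -
  have "log_sqrt_weight (t *\<^sub>R x) = (\<Sum>\<alpha>\<in>Rp. k \<alpha> * ln t + k \<alpha> * ln (\<alpha> \<bullet> x))"
    unfolding log_sqrt_weight_def using chamber_pos[OF assms(1)] assms(2)
    by (intro sum.cong) (auto simp: ln_mult distrib_left less_imp_neq[symmetric])
  then show ?thesis by (simp add: log_sqrt_weight_def sum.distrib sum_distrib_right)
qed

text \<open>The quantity whose limit is sought, as a function of \<open>x\<close> in the chamber; \<open>g\<close> is the index of a component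
of the vector-valued solution.\<close>

definition amplitude ::
  "real ^ 'n \<Rightarrow> (real ^ 'n \<Rightarrow> real ^ 'n) \<Rightarrow> real ^ 'n \<Rightarrow> complex" where
  "amplitude y g x = exp (of_real (log_sqrt_weight x + log_sqrt_weight y) - \<i> * of_real (x \<bullet> g y))
     * kernel_slice \<i> x (g y)"

lemma amplitude_eq:
  assumes "x \<in> C" "y \<in> C"
  shows "of_real (sqrt (dunkl_weight Rp k x * dunkl_weight Rp k y)) * exp (- (\<i> * of_real (x \<bullet> g y))) *
    E (\<i> *s cvec x) (cvec (g y)) = amplitude y g x"
proof -
  have "exp (of_real (log_sqrt_weight x + log_sqrt_weight y) - \<i> * of_real (x \<bullet> g y))
    = of_real (exp (log_sqrt_weight x + log_sqrt_weight y)) * exp (- (\<i> * of_real (x \<bullet> g y)))"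
    by (simp only: exp_of_real diff_conv_add_uminus exp_add)
  then show ?thesis
    by (simp only: amplitude_def sqrt_weight_chamber[OF assms] kernel_scale_complex)
qed

text \<open>Symmetry, invariance and homogeneity of the kernel exchange the roles of the two points, at the price of
inverting \<open>g\<close>. Letting \<open>t\<close> tend to infinity, this turns a limit in the first variable with \<open>y\<close> fixed into
one along the ray of \<open>y\<close> with \<open>x\<close> fixed.\<close>

lemma amplitude_swap:
  assumes "x \<in> C" "y \<in> C" "g \<in> G" "0 < t"
  shows "amplitude y g (t *\<^sub>R x) = amplitude x (inv g) (t *\<^sub>R y)"
proof -
  have g': "inv g \<in> G" by (rule reflection_group.inv) fact
  have "kernel_slice \<i> (t *\<^sub>R x) (g y) = kernel_slice \<i> (inv g (t *\<^sub>R x)) y"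
    using slice_invariant[OF g', of \<i> "t *\<^sub>R x" "g y"] by (simp add: group_inverse assms(3))
  also have "\<dots> = kernel_slice \<i> y (t *\<^sub>R inv g x)"
    by (simp add: group_scale[OF g'] slice_symmetric[of \<i> y])
  finally have "kernel_slice \<i> (t *\<^sub>R x) (g y) = kernel_slice \<i> (t *\<^sub>R y) (inv g x)"
    by (simp add: slice_scale)
  moreover have "t *\<^sub>R x \<bullet> g y = t *\<^sub>R y \<bullet> inv g x"
    by (simp add: group_inner_adjoint[OF assms(3)] inner_commute)
  moreover have "log_sqrt_weight (t *\<^sub>R x) + log_sqrt_weight y = log_sqrt_weight (t *\<^sub>R y) + log_sqrt_weight x"
    by (simp add: log_sqrt_weight_scale assms)
  ultimately show ?thesis by (simp only: amplitude_def)
qed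

text \<open>The logarithmic derivative of the square root of the weight cancels the diagonal part
\<open>f x / (\<alpha> \<bullet> x)\<close> of the Dunkl operator, and the exponential cancels the eigenvalue. Only the
reflected terms remain, and they couple the component \<open>g\<close> to \<open>reflection \<alpha> \<circ> g\<close> with an oscillating factor.\<close>

lemma amplitude_line_derivative:
  assumes p: "x + s *\<^sub>R \<xi> \<in> C" and g: "g \<in> G"
  shows "((\<lambda>s. amplitude y g (x + s *\<^sub>R \<xi>)) has_vector_derivative
    (\<Sum>\<alpha>\<in>Rp. of_real (k \<alpha> * ((\<alpha> \<bullet> \<xi>) / (\<alpha> \<bullet> (x + s *\<^sub>R \<xi>)))) * cis (- ((\<alpha> \<bullet> (x + s *\<^sub>R \<xi>)) * (\<alpha> \<bullet> g y)))
       * amplitude y (reflection \<alpha> \<circ> g) (x + s *\<^sub>R \<xi>))) (at s)"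
proof -
  define P where "P = x + s *\<^sub>R \<xi>"
  define X where "X = exp (of_real (log_sqrt_weight P + log_sqrt_weight y) - \<i> * of_real (P \<bullet> g y))"
  have pos: "0 < \<alpha> \<bullet> P" if "\<alpha> \<in> Rp" for \<alpha> using chamber_pos[OF p that] by (simp add: P_def)
  have 1: "((\<lambda>s. log_sqrt_weight (x + s *\<^sub>R \<xi>)) has_real_derivative (\<Sum>\<alpha>\<in>Rp. k \<alpha> * ((\<alpha> \<bullet> \<xi>) / (\<alpha> \<bullet> P)))) (at s)"
    unfolding log_sqrt_weight_def
    by (intro DERIV_sum DERIV_cmult) (use pos in \<open>auto intro!: derivative_eq_intros simp: P_def inner_add_right\<close>)
  have "((\<lambda>s. (x + s *\<^sub>R \<xi>) \<bullet> g y) has_real_derivative \<xi> \<bullet> g y) (at s)"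
    by (simp add: inner_add_left) (auto intro!: derivative_eq_intros)
  note vd = 1[THEN has_vector_derivative_of_real] this[THEN has_vector_derivative_of_real]
  have "((\<lambda>s. of_real (log_sqrt_weight (x + s *\<^sub>R \<xi>)) + of_real (log_sqrt_weight y) - \<i> * of_real ((x + s *\<^sub>R \<xi>) \<bullet> g y))
     has_vector_derivative of_real (\<Sum>\<alpha>\<in>Rp. k \<alpha> * ((\<alpha> \<bullet> \<xi>) / (\<alpha> \<bullet> P))) + 0 - \<i> * of_real (\<xi> \<bullet> g y)) (at s)"
    by (intro has_vector_derivative_diff has_vector_derivative_add has_vector_derivative_const has_vector_derivative_mult_right vd)
  from field_vector_diff_chain_at[OF this DERIV_exp]
  have "((\<lambda>s. exp (of_real (log_sqrt_weight (x + s *\<^sub>R \<xi>) + log_sqrt_weight y) - \<i> * of_real ((x + s *\<^sub>R \<xi>) \<bullet> g y)))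
     has_vector_derivative (of_real (\<Sum>\<alpha>\<in>Rp. k \<alpha> * ((\<alpha> \<bullet> \<xi>) / (\<alpha> \<bullet> P))) - \<i> * of_real (\<xi> \<bullet> g y)) * X) (at s)"
    by (simp add: o_def X_def P_def)
  from has_vector_derivative_mult[OF this slice_line_derivative[of \<i> x \<xi> "g y" s]]
  have "((\<lambda>s. amplitude y g (x + s *\<^sub>R \<xi>)) has_vector_derivative
      X * frechet_derivative (\<lambda>x. kernel_slice \<i> x (g y)) (at P) \<xi> +
      (of_real (\<Sum>\<alpha>\<in>Rp. k \<alpha> * ((\<alpha> \<bullet> \<xi>) / (\<alpha> \<bullet> P))) - \<i> * of_real (\<xi> \<bullet> g y)) * X * kernel_slice \<i> P (g y)) (at s)"
    by (simp add: amplitude_def X_def P_def)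
  moreover have "X * frechet_derivative (\<lambda>x. kernel_slice \<i> x (g y)) (at P) \<xi> +
      (of_real (\<Sum>\<alpha>\<in>Rp. k \<alpha> * ((\<alpha> \<bullet> \<xi>) / (\<alpha> \<bullet> P))) - \<i> * of_real (\<xi> \<bullet> g y)) * X * kernel_slice \<i> P (g y)
    = X * ((\<Sum>\<alpha>\<in>Rp. of_real (k \<alpha> * ((\<alpha> \<bullet> \<xi>) / (\<alpha> \<bullet> P))) * kernel_slice \<i> P (g y)) -
        (\<Sum>\<alpha>\<in>Rp. of_real (k \<alpha>) * of_real (\<alpha> \<bullet> \<xi>) * dunkl_quotient \<alpha> (\<lambda>x. kernel_slice \<i> x (g y)) P))"
    unfolding slice_equation of_real_sum sum_distrib_right[symmetric] by (simp add: algebra_simps)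
  moreover have "\<dots> = (\<Sum>\<alpha>\<in>Rp. of_real (k \<alpha> * ((\<alpha> \<bullet> \<xi>) / (\<alpha> \<bullet> P))) * (X * kernel_slice \<i> (reflection \<alpha> P) (g y)))"
    unfolding sum_subtractf[symmetric] sum_distrib_left
    by (intro sum.cong) (use pos in \<open>force simp: dunkl_quotient_def field_simps\<close>)+
  moreover have "\<dots> = (\<Sum>\<alpha>\<in>Rp. of_real (k \<alpha> * ((\<alpha> \<bullet> \<xi>) / (\<alpha> \<bullet> P))) * cis (- ((\<alpha> \<bullet> P) * (\<alpha> \<bullet> g y)))
       * amplitude y (reflection \<alpha> \<circ> g) P)"
  proof (intro sum.cong refl)
    fix \<alpha> assume "\<alpha> \<in> Rp"
    then have \<alpha>: "\<alpha> \<in> R" using Rp_subset by auto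
    have "kernel_slice \<i> (reflection \<alpha> P) (g y) = kernel_slice \<i> P (reflection \<alpha> (g y))"
      using slice_invariant[OF reflection_group.reflection[OF \<alpha>], of \<i> P "reflection \<alpha> (g y)"]
      by (simp add: reflection_reflection \<alpha>)
    moreover have "X = cis (- ((\<alpha> \<bullet> P) * (\<alpha> \<bullet> g y))) *
       exp (of_real (log_sqrt_weight P + log_sqrt_weight y) - \<i> * of_real (P \<bullet> reflection \<alpha> (g y)))"
      unfolding X_def cis_conv_exp exp_add[symmetric]
      by (simp add: reflection_root \<alpha> inner_diff_right inner_commute[of P] algebra_simps)
    ultimately show "of_real (k \<alpha> * ((\<alpha> \<bullet> \<xi>) / (\<alpha> \<bullet> P))) * (X * kernel_slice \<i> (reflection \<alpha> P) (g y)) =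
       of_real (k \<alpha> * ((\<alpha> \<bullet> \<xi>) / (\<alpha> \<bullet> P))) * cis (- ((\<alpha> \<bullet> P) * (\<alpha> \<bullet> g y))) * amplitude y (reflection \<alpha> \<circ> g) P"
      by (simp add: amplitude_def)
  qed
  ultimately show ?thesis by (simp only: P_def)
qed

text \<open>The frequencies of the oscillation stay away from \<open>0\<close>, because \<open>g\<close> permutes the roots and no
root hyperplane meets the open chamber.\<close>

lemma regular_orbit_bound:
  assumes y: "y \<in> C"
  obtains c0 where "0 < c0" "\<And>\<alpha> g. \<alpha> \<in> Rp \<Longrightarrow> g \<in> G \<Longrightarrow> c0 \<le> \<bar>\<alpha> \<bullet> g y\<bar>"
proof -
  have pos: "0 < \<bar>\<alpha> \<bullet> y\<bar>" if "\<alpha> \<in> R" for \<alpha>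
  proof -
    have "\<alpha> \<in> Rp \<or> - \<alpha> \<in> Rp" using that positive by (auto simp: positive_subsystem_def)
    then show ?thesis using chamber_pos[OF y, of \<alpha>] chamber_pos[OF y, of "- \<alpha>"] by auto
  qed
  obtain c0 where c0: "0 < c0" "\<And>\<alpha>. \<alpha> \<in> R \<Longrightarrow> c0 \<le> \<bar>\<alpha> \<bullet> y\<bar>"
    using finite_positive_lower_bound[of R "\<lambda>\<alpha>. \<bar>\<alpha> \<bullet> y\<bar>"] pos finite_R by metis
  have "c0 \<le> \<bar>\<alpha> \<bullet> g y\<bar>" if "\<alpha> \<in> Rp" "g \<in> G" for \<alpha> g
  proof -
    have "inv g \<alpha> \<in> R" using group_roots[OF reflection_group.inv[OF that(2)]] that(1) Rp_subset by blast
    then show ?thesis using c0(2) by (simp add: group_inner_adjoint that(2))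
  qed
  then show ?thesis using that c0(1) by blast
qed

lemma amplitude_line_estimate:
  assumes ab: "a \<le> b" and r: "0 < r"
    and line: "\<And>\<alpha> s. \<alpha> \<in> Rp \<Longrightarrow> a \<le> s \<Longrightarrow> s \<le> b \<Longrightarrow> r \<le> \<alpha> \<bullet> (x + s *\<^sub>R \<xi>)"
    and \<phi>: "\<And>s. a \<le> s \<Longrightarrow> s \<le> b \<Longrightarrow> (\<phi> has_real_derivative \<phi>' s) (at s)"
    and \<phi>0: "\<And>s. a \<le> s \<Longrightarrow> s \<le> b \<Longrightarrow> 0 \<le> \<phi>' s"
    and \<phi>': "\<And>\<alpha> \<beta> s. \<alpha> \<in> Rp \<Longrightarrow> \<beta> \<in> Rp \<Longrightarrow> a \<le> s \<Longrightarrow> s \<le> b \<Longrightarrow>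
       \<bar>\<beta> \<bullet> \<xi>\<bar> / ((\<beta> \<bullet> (x + s *\<^sub>R \<xi>)) * (\<alpha> \<bullet> (x + s *\<^sub>R \<xi>))) \<le> \<phi>' s"
    and c0: "0 < c0" "\<And>\<alpha> g. \<alpha> \<in> Rp \<Longrightarrow> g \<in> G \<Longrightarrow> c0 \<le> \<bar>\<alpha> \<bullet> g y\<bar>"
    and \<epsilon>: "(\<kappa> * (1 + \<kappa>) * (\<phi> b - \<phi> a) + 2 * \<kappa> / r) / c0 \<le> \<epsilon>" "\<epsilon> \<le> 1 / 2"
    and N: "\<And>g. g \<in> G \<Longrightarrow> norm (amplitude y g (x + a *\<^sub>R \<xi>)) \<le> N"
    and g: "g \<in> G"
  shows "norm (amplitude y g (x + b *\<^sub>R \<xi>) - amplitude y g (x + a *\<^sub>R \<xi>)) \<le> 2 * \<epsilon> * N"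
proof (rule oscillatory_system_estimate[where F = "\<lambda>g s. amplitude y g (x + s *\<^sub>R \<xi>)" and G = G
      and A = Rp and act = "\<lambda>\<alpha> g. reflection \<alpha> \<circ> g" and \<theta> = "\<lambda>\<alpha> s. \<alpha> \<bullet> (x + s *\<^sub>R \<xi>)"
      and \<theta>' = "\<lambda>\<alpha> s. \<alpha> \<bullet> \<xi>" and c = "\<lambda>\<alpha> g. \<alpha> \<bullet> g y" and k = k])
  show "((\<lambda>s. amplitude y g (x + s *\<^sub>R \<xi>)) has_vector_derivative
    (\<Sum>\<alpha>\<in>Rp. of_real (k \<alpha> * ((\<alpha> \<bullet> \<xi>) / (\<alpha> \<bullet> (x + s *\<^sub>R \<xi>)))) * cis (- ((\<alpha> \<bullet> (x + s *\<^sub>R \<xi>)) * (\<alpha> \<bullet> g y)))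
       * amplitude y (reflection \<alpha> \<circ> g) (x + s *\<^sub>R \<xi>))) (at s)"
    if "g \<in> G" "a \<le> s" "s \<le> b" for g s
    using r line[OF _ that(2,3)]
    by (intro amplitude_line_derivative that(1)) (force simp: weyl_chamber_def intro: less_le_trans)
  show "((\<lambda>s. \<alpha> \<bullet> (x + s *\<^sub>R \<xi>)) has_real_derivative \<alpha> \<bullet> \<xi>) (at s)" for \<alpha> s
    by (simp add: inner_add_right) (auto intro!: derivative_eq_intros)
  show "finite G" "finite Rp" by (rule finite_group finite_Rp)+
  show "reflection \<alpha> \<circ> g \<in> G" if "\<alpha> \<in> Rp" "g \<in> G" for \<alpha> g
    using that Rp_subset by (auto intro: reflection_comp)
  show "0 \<le> k \<alpha>" if "\<alpha> \<in> Rp" for \<alpha> using that Rp_subset multiplicity_nonneg by auto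
qed (fact assms)+

end

section \<open>Existence of the limit and its independence of the parameter\<close>

context dunkl_kernel
begin

lemma chamber_lower_bound:
  assumes "x \<in> C"
  obtains \<rho> where "0 < \<rho>" "\<And>\<alpha>. \<alpha> \<in> Rp \<Longrightarrow> \<rho> \<le> \<alpha> \<bullet> x"
  using finite_positive_lower_bound[of Rp "\<lambda>\<alpha>. \<alpha> \<bullet> x"] finite_Rp chamber_pos[OF assms] by metis

lemma root_inner_le:
  assumes "\<alpha> \<in> Rp"
  shows "\<alpha> \<bullet> x \<le> 2 * norm x"
proof -
  have "(norm \<alpha>)\<^sup>2 \<le> 2\<^sup>2" using assms Rp_subset root_square[of \<alpha>] by (auto simp: power2_norm_eq_inner)
  then have "norm \<alpha> \<le> 2" by (rule power2_le_imp_le) simp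
  then have "norm \<alpha> * norm x \<le> 2 * norm x" by (intro mult_right_mono) auto
  then show ?thesis using norm_cauchy_schwarz[of \<alpha> x] by simp
qed

text \<open>Along a ray the integral of \<open>\<theta>' / \<theta>^2\<close> beyond \<open>t\<close> is of order \<open>1 / t\<close>, whatever the length of the piece.\<close>

lemma amplitude_ray_estimate:
  assumes y: "y \<in> C" and x: "x \<in> C"
  obtains D where "0 \<le> D"
    "\<And>t s N g. 0 < t \<Longrightarrow> t \<le> s \<Longrightarrow> D / t \<le> 1 / 2 \<Longrightarrow>
      (\<And>g. g \<in> G \<Longrightarrow> norm (amplitude y g (t *\<^sub>R x)) \<le> N) \<Longrightarrow> g \<in> G \<Longrightarrow>
      norm (amplitude y g (s *\<^sub>R x) - amplitude y g (t *\<^sub>R x)) \<le> 2 * (D / t) * N"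
proof -
  obtain c0 where c0: "0 < c0" "\<And>\<alpha> g. \<alpha> \<in> Rp \<Longrightarrow> g \<in> G \<Longrightarrow> c0 \<le> \<bar>\<alpha> \<bullet> g y\<bar>"
    using regular_orbit_bound[OF y] by blast
  obtain \<rho> where \<rho>: "0 < \<rho>" "\<And>\<alpha>. \<alpha> \<in> Rp \<Longrightarrow> \<rho> \<le> \<alpha> \<bullet> x" using chamber_lower_bound[OF x] by blast
  define K where "K = \<kappa>"
  have K: "0 \<le> K" using \<kappa>_nonneg by (simp add: K_def)
  define D where "D = (K * (1 + K) + 2 * K) / (\<rho> * c0)"
  show ?thesis
  proof (rule that[of D])
    show "0 \<le> D" using K \<rho>(1) c0(1) by (simp add: D_def)
    fix t s :: real and N g
    assume t: "0 < t" and ts: "t \<le> s" and D: "D / t \<le> 1 / 2"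
      and N: "\<And>g. g \<in> G \<Longrightarrow> norm (amplitude y g (t *\<^sub>R x)) \<le> N" and g: "g \<in> G"
    have "norm (amplitude y g (0 + s *\<^sub>R x) - amplitude y g (0 + t *\<^sub>R x)) \<le> 2 * (D / t) * N"
    proof (rule amplitude_line_estimate[where r = "t * \<rho>" and \<phi> = "\<lambda>u. - (1 / (u * \<rho>))"
          and \<phi>' = "\<lambda>u. 1 / (u\<^sup>2 * \<rho>)", OF ts _ _ _ _ _ c0 _ D _ g])
      show "0 < t * \<rho>" using t \<rho> by simp
      show "t * \<rho> \<le> \<alpha> \<bullet> (0 + u *\<^sub>R x)" if "\<alpha> \<in> Rp" "t \<le> u" for \<alpha> u
        using that \<rho> t by (simp add: mult_mono)
      show "((\<lambda>u. - (1 / (u * \<rho>))) has_real_derivative 1 / (u\<^sup>2 * \<rho>)) (at u)" if "t \<le> u" for u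
        using that t \<rho>(1) by (auto intro!: derivative_eq_intros simp: field_simps power2_eq_square)
      show "0 \<le> 1 / (u\<^sup>2 * \<rho>)" for u using \<rho>(1) by simp
      show "\<bar>\<beta> \<bullet> x\<bar> / ((\<beta> \<bullet> (0 + u *\<^sub>R x)) * (\<alpha> \<bullet> (0 + u *\<^sub>R x))) \<le> 1 / (u\<^sup>2 * \<rho>)"
        if "\<alpha> \<in> Rp" "\<beta> \<in> Rp" "t \<le> u" for \<alpha> \<beta> u
      proof -
        have "0 < u" "0 < \<beta> \<bullet> x" "0 < \<alpha> \<bullet> x" using that t chamber_pos[OF x] by auto
        then have "\<bar>\<beta> \<bullet> x\<bar> / ((\<beta> \<bullet> (0 + u *\<^sub>R x)) * (\<alpha> \<bullet> (0 + u *\<^sub>R x))) = 1 / (u\<^sup>2 * (\<alpha> \<bullet> x))"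
          by (simp add: power2_eq_square)
        also have "\<dots> \<le> 1 / (u\<^sup>2 * \<rho>)"
          using \<open>0 < u\<close> \<open>0 < \<alpha> \<bullet> x\<close> \<rho> that by (intro divide_left_mono mult_left_mono) auto
        finally show ?thesis .
      qed
      have "K * (1 + K) * (1 / (t * \<rho>) - 1 / (s * \<rho>)) \<le> K * (1 + K) * (1 / (t * \<rho>))"
        using K t ts \<rho>(1) by (intro mult_left_mono) auto
      then have "(K * (1 + K) * (1 / (t * \<rho>) - 1 / (s * \<rho>)) + 2 * K / (t * \<rho>)) / c0
          \<le> (K * (1 + K) * (1 / (t * \<rho>)) + 2 * K / (t * \<rho>)) / c0"
        using c0(1) by (intro divide_right_mono add_right_mono) auto
      also have "\<dots> = D / t" using c0(1) t \<rho>(1) by (simp add: D_def field_simps)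
      finally show "(\<kappa> * (1 + \<kappa>) * (- (1 / (s * \<rho>)) - - (1 / (t * \<rho>))) + 2 * \<kappa> / (t * \<rho>)) / c0 \<le> D / t"
        by (simp add: K_def)
      show "norm (amplitude y g (0 + t *\<^sub>R x)) \<le> N" if "g \<in> G" for g using N[OF that] by simp
    qed
    then show "norm (amplitude y g (s *\<^sub>R x) - amplitude y g (t *\<^sub>R x)) \<le> 2 * (D / t) * N" by simp
  qed
qed

text \<open>Segments join points at comparable distances: with \<open>r\<close> and \<open>m\<close> of order \<open>t\<close>, the admissible \<open>\<epsilon>\<close> is of
order \<open>1 / t\<close>.\<close>

lemma amplitude_segment_estimate:
  assumes r: "0 < r" and x: "\<And>\<alpha>. \<alpha> \<in> Rp \<Longrightarrow> r \<le> \<alpha> \<bullet> x" and p: "\<And>\<alpha>. \<alpha> \<in> Rp \<Longrightarrow> r \<le> \<alpha> \<bullet> p"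
    and m: "\<And>\<alpha>. \<alpha> \<in> Rp \<Longrightarrow> \<bar>\<alpha> \<bullet> (p - x)\<bar> \<le> m" "0 \<le> m"
    and c0: "0 < c0" "\<And>\<alpha> g. \<alpha> \<in> Rp \<Longrightarrow> g \<in> G \<Longrightarrow> c0 \<le> \<bar>\<alpha> \<bullet> g y\<bar>"
    and \<epsilon>: "(\<kappa> * (1 + \<kappa>) * (m / r\<^sup>2) + 2 * \<kappa> / r) / c0 \<le> \<epsilon>" "\<epsilon> \<le> 1 / 2"
    and N: "\<And>g. g \<in> G \<Longrightarrow> norm (amplitude y g x) \<le> N" and g: "g \<in> G"
  shows "norm (amplitude y g p - amplitude y g x) \<le> 2 * \<epsilon> * N"
proof -
  have line: "r \<le> \<alpha> \<bullet> (x + u *\<^sub>R (p - x))" if "\<alpha> \<in> Rp" "0 \<le> u" "u \<le> 1" for \<alpha> u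
  proof -
    have "(1 - u) * r + u * r \<le> (1 - u) * (\<alpha> \<bullet> x) + u * (\<alpha> \<bullet> p)"
      using that x p by (intro add_mono mult_left_mono) auto
    then show ?thesis by (simp add: inner_add_right inner_diff_right algebra_simps)
  qed
  have "norm (amplitude y g (x + 1 *\<^sub>R (p - x)) - amplitude y g (x + 0 *\<^sub>R (p - x))) \<le> 2 * \<epsilon> * N"
  proof (rule amplitude_line_estimate[where r = r and \<phi> = "\<lambda>u. u * (m / r\<^sup>2)" and \<phi>' = "\<lambda>u. m / r\<^sup>2",
        OF _ r line _ _ _ c0 _ \<epsilon>(2) _ g])
    show "((\<lambda>u. u * (m / r\<^sup>2)) has_real_derivative m / r\<^sup>2) (at u)" for u
      by (rule DERIV_cmult_right[OF DERIV_ident, simplified])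
    show "\<bar>\<beta> \<bullet> (p - x)\<bar> / ((\<beta> \<bullet> (x + u *\<^sub>R (p - x))) * (\<alpha> \<bullet> (x + u *\<^sub>R (p - x)))) \<le> m / r\<^sup>2"
      if "\<alpha> \<in> Rp" "\<beta> \<in> Rp" "0 \<le> u" "u \<le> 1" for \<alpha> \<beta> u
      unfolding power2_eq_square using m(1)[OF that(2)] m(2) line[OF that(1,3,4)] line[OF that(2,3,4)] r
      by (intro frac_le mult_mono) auto
  qed (use m r \<epsilon>(1) N in simp_all)
  then show ?thesis by simp
qed

text \<open>Convergence in every region where all \<open>\<alpha> \<bullet> p\<close> are comparable with a parameter \<open>t\<close> that tends to infinity.
With \<open>t = norm p\<close> this covers the sets \<open>weyl_chamber_delta Rp \<delta>\<close>. Taking \<open>t\<close> as a separate parameter covers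
the rays \<open>t *\<^sub>R x\<close> as well, including the constant one at \<open>x = 0\<close>, which lies in the chamber if there are no
roots.\<close>

definition asymptotic_constant :: "real ^ 'n \<Rightarrow> ((real ^ 'n \<Rightarrow> real ^ 'n) \<Rightarrow> complex) \<Rightarrow> bool" where
  "asymptotic_constant y L \<longleftrightarrow> (\<forall>\<rho>>0. \<forall>M. \<forall>e>0. \<exists>T>0. \<forall>t\<ge>T. \<forall>p.
     (\<forall>\<alpha>\<in>Rp. \<rho> * t \<le> \<alpha> \<bullet> p \<and> \<alpha> \<bullet> p \<le> M * t) \<longrightarrow> (\<forall>g\<in>G. norm (amplitude y g p - L g) < e))"

lemma amplitude_nonzero:
  assumes "0 < t" shows "\<exists>g\<in>G. amplitude y g (t *\<^sub>R x) \<noteq> 0"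
proof -
  obtain h where h: "h \<in> G" "kernel_slice \<i> (t *\<^sub>R h x) y \<noteq> 0"
    using radial_solution_nonzero[OF slice_radial _ assms slice_ray_continuous, of \<i> y x] by (auto simp: slice_0)
  have "kernel_slice \<i> (t *\<^sub>R h x) y = kernel_slice \<i> (t *\<^sub>R x) (inv h y)"
    using slice_invariant[OF h(1), of \<i> "t *\<^sub>R x" "inv h y"] by (simp add: group_inverse h(1) group_scale)
  then have "amplitude y (inv h) (t *\<^sub>R x) \<noteq> 0" using h(2) by (simp add: amplitude_def)
  then show ?thesis using h(1) reflection_group.inv by blast
qed

text \<open>On the ray of \<open>x\<close> the ray estimate gives a bound, then a limit, and a limit which is not the zero vector
because the relative change beyond \<open>t0\<close> is at most one half. The segment estimate carries the limit to all
points of the region, by comparing them with the point of the ray at the same scale.\<close>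

lemma asymptotic_constant_exists:
  assumes y: "y \<in> C" and x: "x \<in> C"
  obtains L where "asymptotic_constant y L" "\<exists>g\<in>G. L g \<noteq> 0"
proof -
  obtain D where D: "0 \<le> D"
    and est: "\<And>t s N g. 0 < t \<Longrightarrow> t \<le> s \<Longrightarrow> D / t \<le> 1 / 2 \<Longrightarrow>
      (\<And>g. g \<in> G \<Longrightarrow> norm (amplitude y g (t *\<^sub>R x)) \<le> N) \<Longrightarrow> g \<in> G \<Longrightarrow>
      norm (amplitude y g (s *\<^sub>R x) - amplitude y g (t *\<^sub>R x)) \<le> 2 * (D / t) * N"
    using amplitude_ray_estimate[OF y x] by blast
  define t0 where "t0 = 4 * D + 1"
  have t0: "0 < t0" "D / t0 \<le> 1 / 4" using D by (auto simp: t0_def field_simps)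
  define N where "N = Max ((\<lambda>g. norm (amplitude y g (t0 *\<^sub>R x))) ` G)"
  have N: "norm (amplitude y g (t0 *\<^sub>R x)) \<le> N" if "g \<in> G" for g
    unfolding N_def using that finite_group by (intro Max_ge) auto
  have "N \<in> (\<lambda>g. norm (amplitude y g (t0 *\<^sub>R x))) ` G"
    unfolding N_def using finite_group id_in_group by (intro Max_in) auto
  then obtain g0 where g0: "g0 \<in> G" "norm (amplitude y g0 (t0 *\<^sub>R x)) = N" by auto
  have Npos: "0 < N"
    using amplitude_nonzero[OF t0(1), of y x] N by (metis less_le_trans zero_less_norm_iff)
  have half: "norm (amplitude y g (s *\<^sub>R x) - amplitude y g (t0 *\<^sub>R x)) \<le> N / 2" if "t0 \<le> s" "g \<in> G" for s g
  proof -
    have "norm (amplitude y g (s *\<^sub>R x) - amplitude y g (t0 *\<^sub>R x)) \<le> 2 * (D / t0) * N"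
      using t0 that N by (intro est) auto
    also have "\<dots> \<le> 2 * (1 / 4) * N" using t0(2) Npos by (intro mult_right_mono mult_left_mono) auto
    finally show ?thesis by simp
  qed
  have bound: "norm (amplitude y g (s *\<^sub>R x)) \<le> 2 * N" if "t0 \<le> s" "g \<in> G" for s g
    using half[OF that] N[OF that(2)] Npos
      norm_triangle_sub[of "amplitude y g (s *\<^sub>R x)" "amplitude y g (t0 *\<^sub>R x)"] by linarith
  have D_small: "D / t \<le> 1 / 2" if "t0 \<le> t" for t
    using D that by (simp add: t0_def field_simps)
  have "\<exists>L. ((\<lambda>t. amplitude y g (t *\<^sub>R x)) \<longlongrightarrow> L) at_top \<and>
      (\<forall>t\<ge>t0. norm (amplitude y g (t *\<^sub>R x) - L) \<le> 4 * D * N / t)" if g: "g \<in> G" for g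
  proof (rule tendsto_of_inverse_bound[OF t0(1), of "\<lambda>t. amplitude y g (t *\<^sub>R x)" "4 * D * N"])
    show "norm (amplitude y g (s *\<^sub>R x) - amplitude y g (t *\<^sub>R x)) \<le> 4 * D * N / t" if "t0 \<le> t" "t \<le> s" for t s
      using est[OF _ that(2) D_small[OF that(1)] bound[OF that(1)] g] that(1) t0(1) by simp
  qed blast
  then obtain L where L_lim: "\<And>g. g \<in> G \<Longrightarrow> ((\<lambda>t. amplitude y g (t *\<^sub>R x)) \<longlongrightarrow> L g) at_top"
    and L: "\<And>g t. g \<in> G \<Longrightarrow> t0 \<le> t \<Longrightarrow> norm (amplitude y g (t *\<^sub>R x) - L g) \<le> 4 * D * N / t"
    by metis
  have "L g0 \<noteq> 0"
  proof
    assume "L g0 = 0"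
    have "norm (L g0 - amplitude y g0 (t0 *\<^sub>R x)) \<le> N / 2"
      by (rule tendsto_upperbound[OF tendsto_norm[OF tendsto_diff[OF L_lim[OF g0(1)] tendsto_const]]])
        (rule eventually_mono[OF eventually_ge_at_top[of t0] half[OF _ g0(1)]], simp_all)
    then show False using g0(2) Npos by (simp add: \<open>L g0 = 0\<close>)
  qed
  moreover have "asymptotic_constant y L"
    unfolding asymptotic_constant_def
  proof (intro allI impI)
    fix \<rho> M e :: real assume \<rho>: "0 < \<rho>" and e: "0 < e"
    obtain c0 where c0: "0 < c0" "\<And>\<alpha> g. \<alpha> \<in> Rp \<Longrightarrow> g \<in> G \<Longrightarrow> c0 \<le> \<bar>\<alpha> \<bullet> g y\<bar>"
      using regular_orbit_bound[OF y] by blast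
    obtain \<rho>0 where \<rho>0: "0 < \<rho>0" "\<And>\<alpha>. \<alpha> \<in> Rp \<Longrightarrow> \<rho>0 \<le> \<alpha> \<bullet> x" using chamber_lower_bound[OF x] by blast
    define \<mu> where "\<mu> = min \<rho> \<rho>0"
    have \<mu>: "0 < \<mu>" "\<mu> \<le> \<rho>" "\<mu> \<le> \<rho>0" using \<rho> \<rho>0 by (auto simp: \<mu>_def)
    define m where "m = \<bar>M\<bar> + 2 * norm x"
    have m: "0 \<le> m" by (simp add: m_def)
    define K where "K = \<kappa>"
    have K: "0 \<le> K" using \<kappa>_nonneg by (simp add: K_def)
    define B where "B = (K * (1 + K) * (m / \<mu>\<^sup>2) + 2 * K / \<mu>) / c0"
    have B: "0 \<le> B" using K m \<mu>(1) c0(1) by (simp add: B_def)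
    \<comment> \<open>From \<open>t0\<close> on the ray estimates hold, \<open>2 * B\<close> makes the segment estimate applicable, and the quotient
       makes the two errors together smaller than \<open>e\<close>.\<close>
    define T where "T = t0 + 2 * B + (4 * B * N + 4 * D * N) / e + 1"
    have T: "0 < T" "t0 \<le> T" "2 * B \<le> T" "(4 * B * N + 4 * D * N) / e < T"
      using t0 B D Npos e by (auto simp: T_def add_nonneg_pos)
    show "\<exists>T>0. \<forall>t\<ge>T. \<forall>p. (\<forall>\<alpha>\<in>Rp. \<rho> * t \<le> \<alpha> \<bullet> p \<and> \<alpha> \<bullet> p \<le> M * t) \<longrightarrow> (\<forall>g\<in>G. norm (amplitude y g p - L g) < e)"
    proof (intro exI conjI allI impI ballI, rule T(1))
      fix t p g assume tT: "T \<le> t" and p: "\<forall>\<alpha>\<in>Rp. \<rho> * t \<le> \<alpha> \<bullet> p \<and> \<alpha> \<bullet> p \<le> M * t" and g: "g \<in> G"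
      have t: "0 < t" "t0 \<le> t" "2 * B \<le> t" "(4 * B * N + 4 * D * N) / e < t" using tT T by auto
      have "norm (amplitude y g p - amplitude y g (t *\<^sub>R x)) \<le> 2 * (B / t) * (2 * N)"
      proof (rule amplitude_segment_estimate[where r = "t * \<mu>" and m = "t * m", OF _ _ _ _ _ c0 _ _ _ g])
        show "0 < t * \<mu>" using t \<mu> by simp
        show "t * \<mu> \<le> \<alpha> \<bullet> (t *\<^sub>R x)" if "\<alpha> \<in> Rp" for \<alpha>
          using \<rho>0(2)[OF that] \<mu> t(1) by simp
        show p_low: "t * \<mu> \<le> \<alpha> \<bullet> p" if "\<alpha> \<in> Rp" for \<alpha>
        proof -
          have "t * \<mu> \<le> \<rho> * t" using \<mu>(2) t(1) by simp
          then show ?thesis using p that by force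
        qed
        show "\<bar>\<alpha> \<bullet> (p - t *\<^sub>R x)\<bar> \<le> t * m" if "\<alpha> \<in> Rp" for \<alpha>
        proof -
          have "0 \<le> \<alpha> \<bullet> p" using p_low[OF that] \<mu>(1) t(1) by (meson mult_pos_pos less_imp_le order.trans)
          moreover have "\<alpha> \<bullet> p \<le> \<bar>M\<bar> * t" using p that t(1) by (meson abs_ge_self less_imp_le mult_right_mono order.trans)
          moreover have "0 \<le> t * (\<alpha> \<bullet> x)" using chamber_pos[OF x that] t(1) by simp
          moreover have "t * (\<alpha> \<bullet> x) \<le> t * (2 * norm x)" using root_inner_le[OF that, of x] t(1) by (intro mult_left_mono) auto
          ultimately show ?thesis
            by (simp add: inner_diff_right m_def abs_le_iff algebra_simps)
        qed
        show "0 \<le> t * m" using t m by simp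
        have "(K * (1 + K) * (t * m / (t * \<mu>)\<^sup>2) + 2 * K / (t * \<mu>)) / c0 = B / t"
          using t(1) \<mu>(1) c0(1) by (simp add: B_def field_simps power2_eq_square)
        then show "(\<kappa> * (1 + \<kappa>) * (t * m / (t * \<mu>)\<^sup>2) + 2 * \<kappa> / (t * \<mu>)) / c0 \<le> B / t" by (simp add: K_def)
        show "B / t \<le> 1 / 2" using t by (simp add: field_simps)
        show "norm (amplitude y g (t *\<^sub>R x)) \<le> 2 * N" if "g \<in> G" for g using bound[OF t(2) that] .
      qed
      then have "norm (amplitude y g p - L g) \<le> 2 * (B / t) * (2 * N) + 4 * D * N / t"
        using L[OF g t(2)] norm_triangle_ineq[of "amplitude y g p - amplitude y g (t *\<^sub>R x)" "amplitude y g (t *\<^sub>R x) - L g"]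
        by simp
      also have "\<dots> = (4 * B * N + 4 * D * N) / t" by (simp add: add_divide_distrib)
      also have "\<dots> < e" using t(1,4) e by (simp add: field_simps)
      finally show "norm (amplitude y g p - L g) < e" .
    qed
  qed
  ultimately show ?thesis using that g0(1) by blast
qed

lemma asymptotic_constant_ray:
  assumes L: "asymptotic_constant y L" and x: "x \<in> C" and g: "g \<in> G"
  shows "((\<lambda>t. amplitude y g (t *\<^sub>R x)) \<longlongrightarrow> L g) at_top"
proof (rule tendstoI)
  fix e :: real assume e: "0 < e"
  obtain \<rho> where \<rho>: "0 < \<rho>" "\<And>\<alpha>. \<alpha> \<in> Rp \<Longrightarrow> \<rho> \<le> \<alpha> \<bullet> x" using chamber_lower_bound[OF x] by blast
  obtain T where T: "0 < T" "\<And>t p. T \<le> t \<Longrightarrow> \<forall>\<alpha>\<in>Rp. \<rho> * t \<le> \<alpha> \<bullet> p \<and> \<alpha> \<bullet> p \<le> (2 * norm x) * t \<Longrightarrow>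
      \<forall>g\<in>G. norm (amplitude y g p - L g) < e"
    using L[unfolded asymptotic_constant_def] \<rho>(1) e by metis
  have "dist (amplitude y g (t *\<^sub>R x)) (L g) < e" if "T \<le> t" for t
    using T(2)[OF that, of "t *\<^sub>R x"] \<rho>(2) root_inner_le[of _ x] T(1) that g by (auto simp: dist_norm mult.commute)
  then show "\<forall>\<^sub>F t in at_top. dist (amplitude y g (t *\<^sub>R x)) (L g) < e"
    by (auto simp: eventually_at_top_linorder)
qed

text \<open>The right-hand side does not involve \<open>y\<close> and the left-hand side does not involve \<open>x\<close>. So the limit is
independent of \<open>y\<close>.\<close>

lemma asymptotic_constant_swap:
  assumes "asymptotic_constant y L" "asymptotic_constant x L'" "x \<in> C" "y \<in> C" "g \<in> G"
  shows "L g = L' (inv g)"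
proof (rule tendsto_unique)
  show "((\<lambda>t. amplitude y g (t *\<^sub>R x)) \<longlongrightarrow> L g) at_top"
    by (rule asymptotic_constant_ray) fact+
  have "((\<lambda>t. amplitude x (inv g) (t *\<^sub>R y)) \<longlongrightarrow> L' (inv g)) at_top"
    by (rule asymptotic_constant_ray[OF assms(2,4)]) (rule reflection_group.inv, fact)
  then show "((\<lambda>t. amplitude y g (t *\<^sub>R x)) \<longlongrightarrow> L' (inv g)) at_top"
    by (rule tendsto_cong[THEN iffD1, rotated])
      (auto intro: eventually_mono[OF eventually_gt_at_top[of 0]] simp: amplitude_swap assms)
qed simp

lemma asymptotic_constant_chamber:
  assumes L: "asymptotic_constant y L" and g: "g \<in> G" and \<delta>: "0 < \<delta>"
  shows "((amplitude y g) \<longlongrightarrow> L g) (inf at_infinity (principal (weyl_chamber_delta Rp \<delta>)))"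
proof (rule tendstoI)
  fix e :: real assume e: "0 < e"
  obtain T where T: "0 < T" "\<And>t p. T \<le> t \<Longrightarrow> \<forall>\<alpha>\<in>Rp. \<delta> * t \<le> \<alpha> \<bullet> p \<and> \<alpha> \<bullet> p \<le> 2 * t \<Longrightarrow>
      \<forall>g\<in>G. norm (amplitude y g p - L g) < e"
    using L[unfolded asymptotic_constant_def] \<delta> e by metis
  have "dist (amplitude y g x) (L g) < e" if "T \<le> norm x" "x \<in> weyl_chamber_delta Rp \<delta>" for x
    using T(2)[OF that(1), of x] that(2) root_inner_le[of _ x] g
    by (auto simp: dist_norm weyl_chamber_delta_def less_imp_le)
  then show "\<forall>\<^sub>F x in inf at_infinity (principal (weyl_chamber_delta Rp \<delta>)). dist (amplitude y g x) (L g) < e"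
    unfolding eventually_inf_principal eventually_at_infinity by blast
qed

end

theorem theorem5p2:
  fixes R Rp :: "(real ^ 'n) set"
    and k :: "real ^ 'n \<Rightarrow> real"
    and E :: "complex ^ 'n \<Rightarrow> complex ^ 'n \<Rightarrow> complex"
  assumes "root_system R"
    and "normalized_roots R"
    and "positive_subsystem R Rp"
    and "nonneg_multiplicity R k"
    and "is_dunkl_kernel Rp k E"
  shows "\<exists>v :: (real ^ 'n \<Rightarrow> real ^ 'n) \<Rightarrow> complex.
    (\<exists>g\<in>reflection_group R. v g \<noteq> 0) \<and>
    (\<forall>y\<in>weyl_chamber Rp. \<forall>g\<in>reflection_group R. \<forall>\<delta>>0.
      ((\<lambda>x. of_real (sqrt (dunkl_weight Rp k x * dunkl_weight Rp k y)) *
             exp (- (\<i> * of_real (x \<bullet> g y))) *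
             E (\<i> *s cvec x) (cvec (g y)))
        \<longlongrightarrow> v g) (inf at_infinity (principal (weyl_chamber_delta Rp \<delta>))))"
proof -
  interpret dunkl_kernel R Rp k E
    using assms by unfold_locales
  obtain x where x: "x \<in> C"
    using positive by (auto simp: positive_subsystem_def weyl_chamber_def inner_commute)
  obtain L where L: "asymptotic_constant x L" "\<exists>g\<in>G. L g \<noteq> 0"
    using asymptotic_constant_exists[OF x x] by blast
  show ?thesis
  proof (intro exI conjI ballI allI impI)
    obtain h where h: "h \<in> G" "L h \<noteq> 0" using L(2) by blast
    then have "inv (inv h) = h" by (simp add: group_bij inv_inv_eq)
    then show "\<exists>g\<in>G. L (inv g) \<noteq> 0" using h reflection_group.inv by metis
  next
    fix y g and \<delta> :: real assume y: "y \<in> C" and g: "g \<in> G" and \<delta>: "0 < \<delta>"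
    obtain L' where L': "asymptotic_constant y L'" using asymptotic_constant_exists[OF y x] by blast
    have "L' g = L (inv g)" by (rule asymptotic_constant_swap[OF L' L(1) x y g])
    then have "(amplitude y g \<longlongrightarrow> L (inv g)) (inf at_infinity (principal (weyl_chamber_delta Rp \<delta>)))"
      using asymptotic_constant_chamber[OF L' g \<delta>] by simp
    then show "((\<lambda>x. of_real (sqrt (dunkl_weight Rp k x * dunkl_weight Rp k y)) *
             exp (- (\<i> * of_real (x \<bullet> g y))) * E (\<i> *s cvec x) (cvec (g y)))
        \<longlongrightarrow> L (inv g)) (inf at_infinity (principal (weyl_chamber_delta Rp \<delta>)))"
      by (rule tendsto_cong[THEN iffD1, rotated])
        (auto simp: eventually_inf_principal weyl_chamber_delta_def amplitude_eq y intro!: always_eventually)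
  qed
qed

end
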